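(* Let $d\ge1$, let $1<p<\frac{d+2}{d-2}$ if $d\ge3$ and $1<p<\infty$ if $d=1,2$, let $\Omega,\omega\in\mathbb{R}$, $\beta>0$, let $U\subset\mathbb{R}^d$ be a bounded box domain on which either the homogeneous Dirichlet or the periodic boundary condition is imposed, and let $V\in L^\infty(U)$ with $V\ge0$. Let $\phi^n\in H^1(U)\cap L^\infty(U)$ satisfy the boundary condition, and assume that one of the following holds: (i) $d=1$ and $\alpha_n\ge\frac12\max\left\{0,\ \mathrm{ess\,sup}_{\mathbf{x}\in U}\left(V(\mathbf{x})+\omega+\beta|\phi^n(\mathbf{x})|^{p-1}\right)\right\}$; (ii) $d\ge2$ and $\alpha_n\ge\frac12\max\left\{0,\ \mathrm{ess\,sup}_{\mathbf{x}\in U}\left(V(\mathbf{x})+\frac{|\Omega|^2}{2}(x_1^2+x_2^2)+\omega+\beta|\phi^n(\mathbf{x})|^{p-1}\right)\right\}$. For any $\tau>0$, let $\phi^{n+1}$ be the solution on $U$, subject to the boundary condition, of $$\frac{\phi^{n+1}-\phi^n}{\tau}=\tfrac12\Delta\phi^{n+1}-\alpha_n\phi^{n+1}+\left(\alpha_n-V-\omega-\beta|\phi^n|^{p-1}+\Omega L_z\right)\phi^n.$$ Then, for any $\tau>0$, $$\widetilde S^n_{\Omega,\omega}(\phi^{n+1})\le\widetilde S^n_{\Omega,\omega}(\phi^n).$$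
   Context: Functions are complex-valued on $U$, a product of $d$ bounded open intervals, $\mathbf{x}=(x_1,\dots,x_d)$. The boundary condition (homogeneous Dirichlet or periodic) is fixed throughout; functions satisfying it are the elements of $H^1_0(U)$, respectively of the $H^1$ space of functions periodic on $U$, and the linear elliptic equation for $\phi^{n+1}$ is understood in the weak sense in that space. The angular momentum operator is $L_z=i(x_2\partial_{x_1}-x_1\partial_{x_2})$ if $d\ge2$ and $L_z=0$ if $d=1$. The modified action functional (depending on $\phi^n$) is $$\widetilde S^n_{\Omega,\omega}(\varphi)=\int_U\left(\tfrac12|\nabla\varphi|^2+\left(V+\omega+\beta|\phi^n|^{p-1}\right)|\varphi|^2-\Omega\,\overline{\varphi}\,L_z\varphi\right)d\mathbf{x}.$$ *)

theory Defs
  imports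
    "HOL-Probability.Essential_Supremum"
    "HOL-Library.Complex_Order"
begin

text \<open>
  Space is \<open>real ^ 'n\<close> with \<open>d = CARD('n)\<close>.  Elements of function spaces are represented by
  functions on \<open>real ^ 'n\<close> that are Lebesgue measurable on \<open>U\<close>; their values outside \<open>U\<close> and on
  null sets are irrelevant.
\<close>

subsection \<open>Smooth functions\<close>

definition partial :: "'n \<Rightarrow> (real ^ 'n \<Rightarrow> complex) \<Rightarrow> real ^ 'n \<Rightarrow> complex"
  where "partial i f x = frechet_derivative f (at x) (axis i 1)"

primrec Ck :: "nat \<Rightarrow> (real ^ 'n \<Rightarrow> complex) \<Rightarrow> bool"
  where
    "Ck 0 f \<longleftrightarrow> continuous_on UNIV f"
  | "Ck (Suc k) f \<longleftrightarrow> (\<forall>x. f differentiable (at x)) \<and> (\<forall>i. Ck k (partial i f))"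

definition smooth :: "(real ^ 'n \<Rightarrow> complex) \<Rightarrow> bool"
  where "smooth f \<longleftrightarrow> (\<forall>k. Ck k f)"

text \<open>\<open>C\<^sub>c\<^sup>\<infinity>(U)\<close>, its elements being extended by zero to the whole space.\<close>

definition test_functions :: "(real ^ 'n) set \<Rightarrow> (real ^ 'n \<Rightarrow> complex) set"
  where "test_functions U =
    {f. smooth f \<and> compact (closure {x. f x \<noteq> 0}) \<and> closure {x. f x \<noteq> 0} \<subseteq> U}"

text \<open>Smooth functions on the whole space whose period cell is \<open>box a b\<close>.\<close>

definition smooth_periodic :: "real ^ 'n \<Rightarrow> real ^ 'n \<Rightarrow> (real ^ 'n \<Rightarrow> complex) set"
  where "smooth_periodic a b =
    {f. smooth f \<and> (\<forall>i x. f (x + axis i (b $ i - a $ i)) = f x)}"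

subsection \<open>Lebesgue and Sobolev spaces\<close>

definition L2 :: "(real ^ 'n) set \<Rightarrow> (real ^ 'n \<Rightarrow> 'b::euclidean_space) set"
  where "L2 U = {f. f \<in> borel_measurable (lebesgue_on U) \<and>
                    integrable (lebesgue_on U) (\<lambda>x. (norm (f x))\<^sup>2)}"

definition Linf :: "(real ^ 'n) set \<Rightarrow> (real ^ 'n \<Rightarrow> 'b::euclidean_space) set"
  where "Linf U = {f. f \<in> borel_measurable (lebesgue_on U) \<and>
                      (\<exists>C. AE x in lebesgue_on U. norm (f x) \<le> C)}"

definition has_weak_gradient ::
    "(real ^ 'n) set \<Rightarrow> (real ^ 'n \<Rightarrow> complex) \<Rightarrow> (real ^ 'n \<Rightarrow> complex ^ 'n) \<Rightarrow> bool"
  where "has_weak_gradient U u G \<longleftrightarrow>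
    G \<in> L2 U \<and>
    (\<forall>i. \<forall>\<psi>\<in>test_functions U.
       (LINT x|lebesgue_on U. u x * partial i \<psi> x) = - (LINT x|lebesgue_on U. G x $ i * \<psi> x))"

definition H1 :: "(real ^ 'n) set \<Rightarrow> (real ^ 'n \<Rightarrow> complex) set"
  where "H1 U = {u. u \<in> L2 U \<and> (\<exists>G. has_weak_gradient U u G)}"

text \<open>For \<open>u \<in> H1 U\<close> and open \<open>U\<close> the weak gradient is unique up to a null set.\<close>

definition weak_grad :: "(real ^ 'n) set \<Rightarrow> (real ^ 'n \<Rightarrow> complex) \<Rightarrow> real ^ 'n \<Rightarrow> complex ^ 'n"
  where "weak_grad U u = (SOME G. has_weak_gradient U u G)"

definition H1_norm :: "(real ^ 'n) set \<Rightarrow> (real ^ 'n \<Rightarrow> complex) \<Rightarrow> real"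
  where "H1_norm U u =
    sqrt (LINT x|lebesgue_on U. (cmod (u x))\<^sup>2 + (norm (weak_grad U u x))\<^sup>2)"

definition H1_closure ::
    "(real ^ 'n) set \<Rightarrow> (real ^ 'n \<Rightarrow> complex) set \<Rightarrow> (real ^ 'n \<Rightarrow> complex) set"
  where "H1_closure U D =
    {u \<in> H1 U. \<forall>\<epsilon>>0. \<exists>\<psi>\<in>D. \<psi> \<in> H1 U \<and> H1_norm U (\<lambda>x. u x - \<psi> x) < \<epsilon>}"

datatype boundary_condition = Dirichlet | Periodic

text \<open>
  The space of \<open>H\<^sup>1\<close> functions on \<open>box a b\<close> satisfying the boundary condition:
  \<open>H\<^sup>1\<^sub>0\<close>, respectively \<open>H\<^sup>1\<^sub>p\<^sub>e\<^sub>r\<close>.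
\<close>

primrec H1_bc ::
    "boundary_condition \<Rightarrow> real ^ 'n \<Rightarrow> real ^ 'n \<Rightarrow> (real ^ 'n \<Rightarrow> complex) set"
  where
    "H1_bc Dirichlet a b = H1_closure (box a b) (test_functions (box a b))"
  | "H1_bc Periodic a b = H1_closure (box a b) (smooth_periodic a b)"

subsection \<open>The action functional and the scheme\<close>

text \<open>
  The index type \<open>'n\<close> carries no order, so the coordinates \<open>x\<^sub>1, \<dots>, x\<^sub>d\<close> of \<open>x\<close> are
  \<open>x $ \<iota> 1, \<dots>, x $ \<iota> d\<close> for a bijection \<open>\<iota>\<close> from \<open>{1..d}\<close> onto the indices.
\<close>

definition Lz ::
    "(nat \<Rightarrow> 'n) \<Rightarrow> (real ^ 'n) set \<Rightarrow> (real ^ 'n \<Rightarrow> complex) \<Rightarrow> real ^ 'n \<Rightarrow> complex"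
  where "Lz \<iota> U u x =
    (if CARD('n) \<ge> 2
     then \<i> * (of_real (x $ \<iota> 2) * weak_grad U u x $ \<iota> 1 -
               of_real (x $ \<iota> 1) * weak_grad U u x $ \<iota> 2)
     else 0)"

text \<open>
  The integrand of the action is complex because of its last term, so the functional is
  complex-valued; since \<open>L\<^sub>z\<close> is symmetric its values are in fact real.  They are compared with the
  order of \<open>HOL-Library.Complex_Order\<close>: \<open>z \<le> w\<close> iff \<open>Re z \<le> Re w\<close> and \<open>Im z = Im w\<close>.
\<close>

definition modified_action ::
    "(nat \<Rightarrow> 'n) \<Rightarrow> (real ^ 'n) set \<Rightarrow> real \<Rightarrow> (real ^ 'n \<Rightarrow> real) \<Rightarrow> real \<Rightarrow> real \<Rightarrow> real \<Rightarrow>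
     (real ^ 'n \<Rightarrow> complex) \<Rightarrow> (real ^ 'n \<Rightarrow> complex) \<Rightarrow> complex"
  where "modified_action \<iota> U p V \<Omega> \<omega> \<beta> \<phi>n \<phi> =
    (LINT x|lebesgue_on U.
        of_real (1/2 * (norm (weak_grad U \<phi> x))\<^sup>2
                 + (V x + \<omega> + \<beta> * cmod (\<phi>n x) powr (p - 1)) * (cmod (\<phi> x))\<^sup>2)
        - of_real \<Omega> * cnj (\<phi> x) * Lz \<iota> U \<phi> x)"

text \<open>
  \<open>\<phi>'\<close> is a weak solution, in the space fixed by the boundary condition, of
  \<open>(\<phi>' - \<phi>n) / \<tau> = 1/2 \<Delta>\<phi>' - \<alpha> \<phi>' + (\<alpha> - V - \<omega> - \<beta> |\<phi>n|\<^sup>p\<^sup>-\<^sup>1 + \<Omega> L\<^sub>z) \<phi>n\<close>.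
\<close>

definition weak_solution ::
    "boundary_condition \<Rightarrow> (nat \<Rightarrow> 'n) \<Rightarrow> real ^ 'n \<Rightarrow> real ^ 'n \<Rightarrow> real \<Rightarrow> (real ^ 'n \<Rightarrow> real) \<Rightarrow>
     real \<Rightarrow> real \<Rightarrow> real \<Rightarrow> real \<Rightarrow> real \<Rightarrow> (real ^ 'n \<Rightarrow> complex) \<Rightarrow> (real ^ 'n \<Rightarrow> complex) \<Rightarrow> bool"
  where "weak_solution bc \<iota> a b p V \<Omega> \<omega> \<beta> \<alpha> \<tau> \<phi>n \<phi>' \<longleftrightarrow>
    \<phi>' \<in> H1_bc bc a b \<and>
    (\<forall>v\<in>H1_bc bc a b.
      (LINT x|lebesgue_on (box a b). (\<phi>' x - \<phi>n x) / of_real \<tau> * cnj (v x)) =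
      - 1/2 * (LINT x|lebesgue_on (box a b).
           (\<Sum>i\<in>UNIV. weak_grad (box a b) \<phi>' x $ i * cnj (weak_grad (box a b) v x $ i)))
      - of_real \<alpha> * (LINT x|lebesgue_on (box a b). \<phi>' x * cnj (v x))
      + (LINT x|lebesgue_on (box a b).
           (of_real (\<alpha> - V x - \<omega> - \<beta> * cmod (\<phi>n x) powr (p - 1)) * \<phi>n x
            + of_real \<Omega> * Lz \<iota> (box a b) \<phi>n x) * cnj (v x)))"

end

theory Submission
  imports Defs
begin

text \<open>
  Test the weak equation with the increment \<open>e = \<phi>' - \<phi>n\<close>.  Write \<open>W = V + \<omega> + \<beta> |\<phi>n|\<^sup>p\<^sup>-\<^sup>1\<close>.  Since
  \<open>L\<^sub>z\<close> is symmetric on the space with the boundary condition, expanding the action around \<open>\<phi>n\<close> and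
  eliminating the terms linear in \<open>e\<close> by the tested equation leaves the difference of the actions equal to
  \<open>- (2/\<tau>) \<parallel>e\<parallel>\<^sup>2 - \<integral> (2\<alpha> - W) |e|\<^sup>2 - 1/2 \<parallel>\<nabla>e\<parallel>\<^sup>2 - \<Omega> \<langle>L\<^sub>z e, e\<rangle>\<close>.
  Pointwise, \<open>|\<Omega> e\<^sup>* L\<^sub>z e| \<le> 1/2 |\<nabla>e|\<^sup>2 + \<Omega>\<^sup>2/2 (x\<^sub>1\<^sup>2 + x\<^sub>2\<^sup>2) |e|\<^sup>2\<close>, and the lower bound on \<open>\<alpha>\<close> absorbs
  the rest.  Symmetry of \<open>L\<^sub>z\<close> amounts to \<open>\<integral> x\<^sub>l \<partial>\<^sub>k (u v\<^sup>*) = 0\<close> for \<open>k \<noteq> l\<close>; this holds for smooth functions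
  satisfying the boundary condition and passes to the \<open>H\<^sup>1\<close> closure by density.
\<close>

subsection \<open>Smooth functions\<close>

text \<open>With the density \<open>|\<phi>n|^(p-1)\<close> frozen, the action is a quadratic form
  in its last argument, so the expansion around \<open>\<phi>n\<close> is exact. The scheme treats
  the Laplacian implicitly and pairs the gradient of \<open>\<phi>'\<close>, not of
  \<open>\<phi>n\<close>, with that of \<open>e\<close>; this turns the \<open>+1/2\<close> in front
  of the squared norm of the gradient of \<open>e\<close> into \<open>-1/2\<close>. The rotation
  term spends exactly this gain, whence the \<open>\<Omega>^2/2\<close> in the bound on \<alpha>.

  Two obstacles shape the preparation. \<open>weak_grad\<close> is an arbitrary choice, so its
  linearity and its agreement with classical derivatives hold only a.e. and rest on uniqueness; that
  in turn needs enough test functions, hence explicit bumps. The boundary condition is known only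
  through approximation, without traces, so boundary terms are treated as a form that is continuous
  in the H^1 norm and zero on the approximating class.

  The action is complex-valued and \<open>\<le>\<close> also demands equal imaginary parts, so the
  symmetry of \<open>Lz\<close> is used a second time there.\<close>

lemma partial_eqI:
  fixes f :: "real ^ 'n \<Rightarrow> complex"
  assumes "(f has_derivative f') (at x)"
  shows "partial i f x = f' (axis i 1)"
  using frechet_derivative_at[OF assms] by (simp add: partial_def)

lemma partial_add:
  fixes f g :: "real ^ 'n \<Rightarrow> complex"
  assumes "\<And>x. f differentiable (at x)" "\<And>x. g differentiable (at x)"
  shows "partial i (\<lambda>x. f x + g x) = (\<lambda>x. partial i f x + partial i g x)"
  using has_derivative_add[OF assms[THEN frechet_derivative_works[THEN iffD1]]]
  by (auto simp: fun_eq_iff partial_def[of _ f] partial_def[of _ g] dest!: partial_eqI)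

lemma partial_mult:
  fixes f g :: "real ^ 'n \<Rightarrow> complex"
  assumes "\<And>x. f differentiable (at x)" "\<And>x. g differentiable (at x)"
  shows "partial i (\<lambda>x. f x * g x) = (\<lambda>x. f x * partial i g x + partial i f x * g x)"
  using has_derivative_mult[OF assms[THEN frechet_derivative_works[THEN iffD1]]]
  by (auto simp: fun_eq_iff partial_def[of _ f] partial_def[of _ g] dest!: partial_eqI)

lemma partial_cnj:
  fixes f :: "real ^ 'n \<Rightarrow> complex"
  assumes "\<And>x. f differentiable (at x)"
  shows "partial i (\<lambda>x. cnj (f x)) = (\<lambda>x. cnj (partial i f x))"
  using has_derivative_cnj[OF assms[THEN frechet_derivative_works[THEN iffD1]]]
  by (auto simp: fun_eq_iff partial_def[of _ f] dest!: partial_eqI)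

lemma partial_const: "partial i (\<lambda>x :: real ^ 'n. c :: complex) = (\<lambda>x. 0)"
  by (auto simp: fun_eq_iff intro: partial_eqI[OF has_derivative_const])

lemma Ck_const: "Ck k (\<lambda>x :: real ^ 'n. c)"
  by (induction k arbitrary: c) (simp_all add: partial_const)

lemma Ck_continuous: "Ck k f \<Longrightarrow> continuous_on UNIV f"
  by (cases k) (auto intro!: continuous_at_imp_continuous_on differentiable_imp_continuous_within)

lemma Ck_mono: "Ck (Suc k) f \<Longrightarrow> Ck k f"
proof (induction k arbitrary: f)
  case 0
  then show ?case using Ck_continuous[OF 0] by simp
qed auto

lemma Ck_add: "Ck k f \<Longrightarrow> Ck k g \<Longrightarrow> Ck k (\<lambda>x. f x + g x)"
  by (induction k arbitrary: f g) (auto intro: continuous_intros simp: partial_add)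

text \<open>The product rule leaves \<open>f\<close> undifferentiated beside a derivative of
  \<open>g\<close>, so the induction hypothesis is applied to \<open>f\<close> itself at the lower
  order; \<open>Ck_mono\<close> lowers it.\<close>

lemma Ck_mult: "Ck k f \<Longrightarrow> Ck k g \<Longrightarrow> Ck k (\<lambda>x. f x * g x)"
proof (induction k arbitrary: f g)
  case (Suc k)
  then show ?case
    using Ck_mono[OF Suc.prems(1)] Ck_mono[OF Suc.prems(2)] by (auto simp: partial_mult intro!: Ck_add)
qed (auto intro: continuous_intros)

lemma smooth_const: "smooth (\<lambda>x :: real ^ 'n. c)"
  by (simp add: smooth_def Ck_const)

lemma smooth_add: "smooth f \<Longrightarrow> smooth g \<Longrightarrow> smooth (\<lambda>x. f x + g x)"
  by (simp add: smooth_def Ck_add)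

lemma smooth_mult: "smooth f \<Longrightarrow> smooth g \<Longrightarrow> smooth (\<lambda>x. f x * g x)"
  by (simp add: smooth_def Ck_mult)

lemma smooth_diff: "smooth f \<Longrightarrow> smooth g \<Longrightarrow> smooth (\<lambda>x. f x - g x)"
  using smooth_add[of f "\<lambda>x. (-1) * g x"] smooth_mult[OF smooth_const[of "-1"], of g] by simp

lemma smooth_prod:
  "finite J \<Longrightarrow> (\<And>j. j \<in> J \<Longrightarrow> smooth (f j)) \<Longrightarrow> smooth (\<lambda>x. \<Prod>j\<in>J. f j x)"
  by (induction J rule: finite_induct) (auto intro!: smooth_mult smooth_const)

lemma smooth_differentiable: "smooth f \<Longrightarrow> f differentiable (at x)"
  unfolding smooth_def by (metis Ck.simps(2))

lemma smooth_partial: "smooth f \<Longrightarrow> smooth (partial i f)"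
  unfolding smooth_def by (metis Ck.simps(2))

lemma smooth_continuous: "smooth f \<Longrightarrow> continuous_on UNIV f"
  unfolding smooth_def by (metis Ck.simps(1))

subsection \<open>Bump functions\<close>

text \<open>The index \<open>m\<close> makes the family closed under differentiation up to linear
  combinations, so that smoothness of the classical flat function exp(-1/t) becomes one induction
  over all \<open>m\<close> at once.\<close>

definition flat_exp :: "nat \<Rightarrow> real \<Rightarrow> real"
  where "flat_exp m t = (if t > 0 then (1 / t) ^ m * exp (- (1 / t)) else 0)"

text \<open>Substituting s = 1/t turns the right-hand limit into s^m / e^s at infinity; to the left
  of 0 the function vanishes.\<close>

lemma flat_exp_tendsto_0: "(flat_exp m \<longlongrightarrow> 0) (at 0)"
proof -
  have "((\<lambda>t. (1 / t) ^ m / exp (1 / t)) \<longlongrightarrow> (0::real)) (at_right 0)"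
    using filterlim_compose[OF tendsto_power_div_exp_0 filterlim_inverse_at_top_right]
    by (simp add: inverse_eq_divide)
  then have "(flat_exp m \<longlongrightarrow> 0) (at_right 0)"
    by (rule Lim_transform_eventually)
      (auto simp: flat_exp_def eventually_at_right_less exp_minus field_simps
        intro: eventually_mono[OF eventually_at_right_less[of 0]])
  moreover have "(flat_exp m \<longlongrightarrow> 0) (at_left 0)"
    by (rule tendsto_eventually) (auto simp: flat_exp_def eventually_at_filter)
  ultimately show ?thesis
    by (simp add: filterlim_split_at)
qed

lemma DERIV_flat_exp:
  "(flat_exp m has_real_derivative - real m * flat_exp (Suc m) t + flat_exp (m + 2) t) (at t)"
proof -
  consider "t < 0" | "t = 0" | "t > 0" by linarith
  then show ?thesis
  proof cases
    case 1
    have "((\<lambda>t. 0) has_real_derivative - real m * flat_exp (Suc m) t + flat_exp (m + 2) t) (at t)"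
      using 1 by (simp add: flat_exp_def)
    then show ?thesis
      by (rule DERIV_cong_ev[OF refl _ refl, THEN iffD1, rotated])
        (use 1 in \<open>auto simp: flat_exp_def intro!: eventually_mono[OF eventually_nhds_in_open[of "{..<0}"]]\<close>)
  next
    case 2
    \<comment> \<open>At 0 the difference quotient of index \<open>m\<close> is again a member of
      the family, of index \<open>Suc m\<close>, so its limit is already known.\<close>
    have "((\<lambda>h. (flat_exp m (0 + h) - flat_exp m 0) / h) \<longlongrightarrow> 0) (at 0)"
      by (rule Lim_transform_eventually[OF flat_exp_tendsto_0[of "Suc m"]])
        (auto simp: flat_exp_def eventually_at_filter field_simps)
    then show ?thesis
      unfolding DERIV_def using 2 by (simp add: flat_exp_def)
  next
    case 3
    have "((\<lambda>t. (1 / t) ^ m * exp (- (1 / t))) has_real_derivative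
       - real m * flat_exp (Suc m) t + flat_exp (m + 2) t) (at t)"
    \<comment> \<open>The power rule produces the exponent \<open>m - 1\<close> in truncated
      subtraction, hence the separate case of exponent 0.\<close>
    proof (cases m)
      case (Suc k)
      show ?thesis
        using 3 unfolding Suc
        by (auto intro!: derivative_eq_intros simp: flat_exp_def power_divide)
          (cases k; simp add: divide_simps; simp add: algebra_simps)
    qed (use 3 in \<open>auto intro!: derivative_eq_intros simp: flat_exp_def field_simps power2_eq_square\<close>)
    then show ?thesis
      by (rule DERIV_cong_ev[OF refl _ refl, THEN iffD1, rotated])
        (use 3 in \<open>auto simp: flat_exp_def intro!: eventually_mono[OF eventually_nhds_in_open[of "{0<..}"]]\<close>)
  qed
qed

lemma flat_exp_nonneg: "0 \<le> flat_exp m t" and flat_exp_le_1: "flat_exp 0 t \<le> 1"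
  by (auto simp: flat_exp_def)

text \<open>The scale \<open>s\<close> may be negative, so that one statement serves both the lower
  and the upper face of a box.\<close>

lemma partial_flat_exp:
  fixes i :: "'n::finite" and s c :: real
  defines "F \<equiv> \<lambda>m (x :: real ^ 'n). complex_of_real (flat_exp m (s * (x $ i - c)))"
  shows "F m differentiable (at x)"
    and "partial j (F m) =
      (\<lambda>x. (if i = j then of_real s else 0) * (of_real (- real m) * F (Suc m) x + F (m + 2) x))"
proof -
  have D: "(F m has_derivative
      (\<lambda>h. of_real ((- real m * flat_exp (Suc m) (s * (x $ i - c)) + flat_exp (m + 2) (s * (x $ i - c)))
        * (s * h $ i)))) (at x)" for x
    unfolding F_def
    by (rule has_derivative_of_real,
        rule DERIV_compose_FDERIV[OF DERIV_flat_exp, where g = "\<lambda>x. s * (x $ i - c)", THEN has_derivative_eq_rhs])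
      (auto intro!: derivative_eq_intros bounded_linear.has_derivative[OF bounded_linear_vec_nth] simp: fun_eq_iff)
  show "F m differentiable (at x)"
    using D unfolding differentiable_def by blast
  show "partial j (F m) =
      (\<lambda>x. (if i = j then of_real s else 0) * (of_real (- real m) * F (Suc m) x + F (m + 2) x))"
    by (rule ext, subst partial_eqI[OF D]) (simp add: F_def axis_def)
qed

lemma smooth_flat_exp:
  fixes i :: "'n::finite"
  shows "smooth (\<lambda>x :: real ^ 'n. complex_of_real (flat_exp m (s * (x $ i - c))))"
proof -
  have "Ck k (\<lambda>x :: real ^ 'n. complex_of_real (flat_exp m (s * (x $ i - c))))" for k
  proof (induction k arbitrary: m)
    case 0
    show ?case
      unfolding Ck.simps
      by (intro continuous_at_imp_continuous_on ballI differentiable_imp_continuous_within partial_flat_exp(1))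
  next
    case (Suc k)
    show ?case
      unfolding Ck.simps partial_flat_exp(2)
      by (intro conjI allI partial_flat_exp(1) Ck_mult Ck_add Ck_const Suc)
  qed
  then show ?thesis by (simp add: smooth_def)
qed

text \<open>Each factor is exp(-1/(k t)) with t the distance to a face. It is smooth for fixed
  \<open>k\<close> and tends to 1 inside the box as \<open>k\<close> grows, so these bumps
  approximate the indicator of the box without any convolution.\<close>

definition box_bump :: "real ^ 'n \<Rightarrow> real ^ 'n \<Rightarrow> nat \<Rightarrow> real ^ 'n \<Rightarrow> complex"
  where "box_bump c d k x =
    (\<Prod>i\<in>UNIV. complex_of_real (flat_exp 0 (real k * (x $ i - c $ i)))
       * complex_of_real (flat_exp 0 ((- real k) * (x $ i - d $ i))))"

lemma box_bump_nonzero: "box_bump c d k x \<noteq> 0 \<Longrightarrow> x \<in> box c d"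
  by (fastforce simp: box_bump_def flat_exp_def mem_box_cart zero_less_mult_iff mult_less_0_iff
      split: if_splits)

lemma box_bump_test_function:
  assumes "cbox c d \<subseteq> U"
  shows "box_bump c d k \<in> test_functions U"
proof -
  have "smooth (box_bump c d k)"
    unfolding box_bump_def by (intro smooth_prod smooth_mult smooth_flat_exp) auto
  moreover have sub: "closure {x. box_bump c d k x \<noteq> 0} \<subseteq> cbox c d"
    using box_bump_nonzero box_subset_cbox by (intro closure_minimal) blast+
  moreover have "compact (closure {x. box_bump c d k x \<noteq> 0})"
    using sub by (meson bounded_cbox bounded_subset closed_closure compact_eq_bounded_closed)
  ultimately show ?thesis
    using assms by (auto simp: test_functions_def)
qed

lemma norm_box_bump_le: "norm (box_bump c d k x) \<le> 1"
  unfolding box_bump_def prod_norm[symmetric]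
  by (auto simp: norm_mult flat_exp_nonneg flat_exp_le_1 intro!: prod_le_1 mult_le_one)

lemma box_bump_tendsto: "(\<lambda>k. box_bump c d (Suc k) x) \<longlonglongrightarrow> indicator (box c d) x"
proof (cases "x \<in> box c d")
  case True
  have *: "(\<lambda>k. complex_of_real (flat_exp 0 (real (Suc k) * t))) \<longlonglongrightarrow> 1" if "t > 0" for t
  proof -
    have "(\<lambda>k. exp (- (1 / t * inverse (real (Suc k))))) \<longlonglongrightarrow> exp (- (1 / t * 0))"
      by (intro tendsto_intros LIMSEQ_inverse_real_of_nat)
    then have "(\<lambda>k. flat_exp 0 (real (Suc k) * t)) \<longlonglongrightarrow> 1"
      using that by (simp add: flat_exp_def inverse_eq_divide mult.commute[of t] del: of_nat_Suc)
    from tendsto_of_real[OF this] show ?thesis by simp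
  qed
  have "(\<lambda>k. box_bump c d (Suc k) x) \<longlonglongrightarrow> (\<Prod>i\<in>(UNIV :: 'a set). 1 * 1)"
    unfolding box_bump_def
  proof (intro tendsto_prod tendsto_mult)
    fix i
    show "(\<lambda>k. complex_of_real (flat_exp 0 (real (Suc k) * (x $ i - c $ i)))) \<longlonglongrightarrow> 1"
      using True by (intro *) (auto simp: mem_box_cart)
    have "(\<lambda>k. complex_of_real (flat_exp 0 (real (Suc k) * (d $ i - x $ i)))) \<longlonglongrightarrow> 1"
      using True by (intro *) (auto simp: mem_box_cart)
    moreover have "- real k * (x $ i - d $ i) = real k * (d $ i - x $ i)" for k
      by (simp only: minus_mult_left[symmetric] minus_mult_right minus_diff_eq)
    ultimately show "(\<lambda>k. complex_of_real (flat_exp 0 (- real (Suc k) * (x $ i - d $ i)))) \<longlonglongrightarrow> 1"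
      by (simp only:)
  qed
  then show ?thesis using True by simp
next
  case False
  then have "box_bump c d k x = 0" for k
    using box_bump_nonzero by blast
  then show ?thesis using False by simp
qed

subsection \<open>Square-integrable functions\<close>

lemma L2_measurable: "f \<in> L2 U \<Longrightarrow> f \<in> borel_measurable (lebesgue_on U)"
  and L2_integrable_norm: "f \<in> L2 U \<Longrightarrow> integrable (lebesgue_on U) (\<lambda>x. (norm (f x))\<^sup>2)"
  by (auto simp: L2_def)

lemma norm_add_sq_le: "(norm (x + y))\<^sup>2 \<le> 2 * (norm x)\<^sup>2 + 2 * (norm y)\<^sup>2"
  for x y :: "'a::real_normed_vector"
proof -
  have "(norm (x + y))\<^sup>2 \<le> (norm x + norm y)\<^sup>2"
    by (intro power_mono norm_triangle_ineq norm_ge_zero)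
  also have "\<dots> \<le> 2 * (norm x)\<^sup>2 + 2 * (norm y)\<^sup>2"
    using zero_le_power2[of "norm x - norm y"] by (simp add: power2_eq_square algebra_simps)
  finally show ?thesis .
qed

lemma norm_diff_sq_le: "(norm (x - y))\<^sup>2 \<le> 2 * (norm x)\<^sup>2 + 2 * (norm y)\<^sup>2"
  for x y :: "'a::real_normed_vector"
  using norm_add_sq_le[of x "- y"] by simp

lemma L2_add:
  assumes "f \<in> L2 U" "g \<in> L2 U"
  shows "(\<lambda>x. f x + g x) \<in> L2 U"
proof -
  note [measurable] = assms[THEN L2_measurable]
  have "integrable (lebesgue_on U) (\<lambda>x. (norm (f x + g x))\<^sup>2)"
    by (rule Bochner_Integration.integrable_bound
        [where f = "\<lambda>x. 2 * (norm (f x))\<^sup>2 + 2 * (norm (g x))\<^sup>2"])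
      (auto intro!: Bochner_Integration.integrable_add integrable_mult_right assms[THEN L2_integrable_norm] norm_add_sq_le)
  then show ?thesis by (simp add: L2_def)
qed

lemma L2_diff:
  assumes "f \<in> L2 U" "g \<in> L2 U"
  shows "(\<lambda>x. f x - g x) \<in> L2 U"
proof -
  have "(\<lambda>x. - g x) \<in> L2 U"
    using assms(2) by (auto simp: L2_def)
  from L2_add[OF assms(1) this] show ?thesis by simp
qed

lemma L2_bound:
  assumes "f \<in> L2 U" and [measurable]: "h \<in> borel_measurable (lebesgue_on U)"
    and "AE x in lebesgue_on U. norm (h x) \<le> C * norm (f x)"
  shows "h \<in> L2 U"
proof -
  note [measurable] = assms(1)[THEN L2_measurable]
  have "AE x in lebesgue_on U. norm ((norm (h x))\<^sup>2) \<le> norm (C\<^sup>2 * (norm (f x))\<^sup>2)"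
    using assms(3)
  proof eventually_elim
    case (elim x)
    have "(norm (h x))\<^sup>2 \<le> (C * norm (f x))\<^sup>2"
      using elim by (rule power_mono) simp
    then show ?case by (simp add: power_mult_distrib)
  qed
  then have "integrable (lebesgue_on U) (\<lambda>x. (norm (h x))\<^sup>2)"
    by (rule Bochner_Integration.integrable_bound[rotated 2])
      (auto intro!: integrable_mult_right assms(1)[THEN L2_integrable_norm])
  then show ?thesis by (simp add: L2_def)
qed

lemma L2_cnj:
  assumes "f \<in> L2 U"
  shows "(\<lambda>x. cnj (f x)) \<in> L2 U"
proof (rule L2_bound[where f = f and C = 1, OF assms])
  have "cnj \<in> borel_measurable borel"
    by (intro borel_measurable_continuous_onI linear_continuous_on bounded_linear_cnj)
  from measurable_compose[OF L2_measurable[OF assms] this]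
  show "(\<lambda>x. cnj (f x)) \<in> borel_measurable (lebesgue_on U)" .
qed simp

lemma L2_vec_nth:
  fixes G :: "real ^ 'n \<Rightarrow> complex ^ 'm"
  assumes "G \<in> L2 U"
  shows "(\<lambda>x. G x $ i) \<in> L2 U"
proof (rule L2_bound[where f = G and C = 1, OF assms])
  have "(\<lambda>y :: complex ^ 'm. y $ i) \<in> borel_measurable borel"
    by (intro borel_measurable_continuous_onI linear_continuous_on bounded_linear_vec_nth)
  from measurable_compose[OF L2_measurable[OF assms] this]
  show "(\<lambda>x. G x $ i) \<in> borel_measurable (lebesgue_on U)" .
qed (simp add: Finite_Cartesian_Product.norm_nth_le)

lemma L2_bounded:
  fixes h :: "real ^ 'n \<Rightarrow> 'b::euclidean_space"
  assumes "U \<in> lmeasurable" and [measurable]: "h \<in> borel_measurable (lebesgue_on U)"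
    and "AE x in lebesgue_on U. norm (h x) \<le> C"
  shows "h \<in> L2 U"
proof -
  have "(\<lambda>x. 1 :: real) \<in> L2 U"
    by (simp add: L2_def finite_measure.integrable_const finite_measure_lebesgue_on assms(1))
  from L2_bound[OF this assms(2), of C] assms(3) show ?thesis by simp
qed

lemma L2_mult_bounded:
  fixes f h :: "real ^ 'n \<Rightarrow> complex"
  assumes "f \<in> L2 U" and [measurable]: "h \<in> borel_measurable (lebesgue_on U)"
    and "AE x in lebesgue_on U. norm (h x) \<le> C"
  shows "(\<lambda>x. h x * f x) \<in> L2 U"
proof -
  note [measurable] = assms(1)[THEN L2_measurable]
  have "AE x in lebesgue_on U. norm (h x * f x) \<le> C * norm (f x)"
    using assms(3) by eventually_elim (simp add: norm_mult mult_right_mono)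
  then show ?thesis
    by (intro L2_bound[OF assms(1), where C = C]) measurable
qed

lemma L2_mult_integrable:
  fixes f g :: "real ^ 'n \<Rightarrow> complex"
  assumes "f \<in> L2 U" "g \<in> L2 U"
  shows "integrable (lebesgue_on U) (\<lambda>x. f x * g x)"
proof -
  note [measurable] = assms[THEN L2_measurable]
  have "norm (f x * g x) \<le> (norm (f x))\<^sup>2 + (norm (g x))\<^sup>2" for x
  proof -
    have "norm (f x) * norm (g x) \<le> 2 * norm (f x) * norm (g x)"
      by (simp add: mult_right_mono)
    also have "\<dots> \<le> (norm (f x))\<^sup>2 + (norm (g x))\<^sup>2"
      by (rule sum_squares_bound)
    finally show ?thesis by (simp add: norm_mult)
  qed
  then show ?thesis
    by (intro Bochner_Integration.integrable_bound
        [OF Bochner_Integration.integrable_add[OF assms[THEN L2_integrable_norm]], of "\<lambda>x. f x * g x"]) auto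
qed

lemma L2_integrable:
  fixes f :: "real ^ 'n \<Rightarrow> complex"
  assumes "U \<in> lmeasurable" "f \<in> L2 U"
  shows "integrable (lebesgue_on U) f"
  using L2_mult_integrable[OF assms(2) L2_bounded[OF assms(1), of "\<lambda>x. 1" 1]] by simp

subsection \<open>Uniqueness of weak gradients\<close>

text \<open>The indicator of a box is the pointwise limit of test functions bounded by 1, so
  orthogonality to test functions passes to it by dominated convergence with
  \<open>norm (g x)\<close> as majorant.\<close>

lemma integral_indicator_box_eq_0:
  fixes g :: "real ^ 'n \<Rightarrow> complex"
  assumes g: "integrable (lebesgue_on U) g" and U: "U \<in> sets lebesgue" "cbox c d \<subseteq> U"
    and zero: "\<And>\<psi>. \<psi> \<in> test_functions U \<Longrightarrow> (LINT x|lebesgue_on U. g x * \<psi> x) = 0"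
  shows "(LINT x|lebesgue_on U. indicator (box c d) x * g x) = 0"
proof (rule LIMSEQ_unique)
  note [measurable] = borel_measurable_integrable[OF g]
  have bm: "box_bump c d k \<in> borel_measurable (lebesgue_on U)" for k
    using box_bump_test_function[OF U(2)] U(1)
    by (auto simp: test_functions_def intro!: continuous_imp_measurable_on_sets_lebesgue
        continuous_on_subset[OF smooth_continuous])
  note [measurable] = bm
  have [measurable]: "box c d \<in> sets lebesgue" by simp
  show "(\<lambda>k. LINT x|lebesgue_on U. g x * box_bump c d (Suc k) x)
      \<longlonglongrightarrow> (LINT x|lebesgue_on U. indicator (box c d) x * g x)"
  proof (rule integral_dominated_convergence[where w = "\<lambda>x. norm (g x)"])
    show "(\<lambda>x. indicator (box c d) x * g x) \<in> borel_measurable (lebesgue_on U)"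
      by (intro borel_measurable_times borel_measurable_indicator borel_measurable_integrable[OF g])
        (simp add: sets_restrict_space_iff U(1), metis U box_subset_cbox order_trans)
    show "AE x in lebesgue_on U. (\<lambda>k. g x * box_bump c d (Suc k) x) \<longlonglongrightarrow> indicator (box c d) x * g x"
      using tendsto_mult[OF tendsto_const box_bump_tendsto, of "g _" c d] by (simp add: mult.commute)
    show "AE x in lebesgue_on U. norm (g x * box_bump c d (Suc k) x) \<le> norm (g x)" for k
      using norm_box_bump_le[of c d "Suc k"] by (auto simp: norm_mult intro!: mult_left_le)
  qed (use g in auto)
  show "(\<lambda>k. LINT x|lebesgue_on U. g x * box_bump c d (Suc k) x) \<longlonglongrightarrow> 0"
    using zero[OF box_bump_test_function[OF U(2)]] by simp
qed

lemma cbox_subset_cbox_of_box: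
  fixes c d y z :: "'a::euclidean_space"
  assumes "y \<in> box c d" "z \<in> box c d"
  shows "cbox y z \<subseteq> cbox c d"
  using assms unfolding subset_box(1) mem_box by (auto intro: less_imp_le)

text \<open>The fundamental lemma of the calculus of variations. The integrals over all closed boxes
  inside \<open>U\<close> vanish, and Lebesgue differentiation recovers the function a.e. from its
  averages over small boxes.\<close>

lemma test_functions_separate:
  fixes g :: "real ^ 'n \<Rightarrow> complex"
  assumes U: "open U" and g: "integrable (lebesgue_on U) g"
    and zero: "\<And>\<psi>. \<psi> \<in> test_functions U \<Longrightarrow> (LINT x|lebesgue_on U. g x * \<psi> x) = 0"
  shows "AE x in lebesgue_on U. g x = 0"
proof -
  \<comment> \<open>Extension by zero, because the differentiation theorem used below concerns
    functions on the whole space.\<close>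
  define f where "f x = (if x \<in> U then g x else 0)" for x
  have Us [simp]: "U \<in> sets lebesgue" using U by auto
  have f: "integrable lebesgue f"
    using g unfolding f_def by (simp add: integrable_restrict_space indicator_scaleR_eq_if)
  have fint: "f integrable_on cbox c d" for c d
  proof -
    have "integrable (lebesgue_on (cbox c d)) f"
      using integrable_mult_indicator[of "cbox c d" lebesgue f] f by (simp add: integrable_restrict_space)
    then show ?thesis by (rule integrable_on_lebesgue_on) simp
  qed
  have zero': "integral (cbox c d) f = 0" if "cbox c d \<subseteq> U" for c d
  proof -
    have sub: "box c d \<subseteq> U" using that box_subset_cbox by blast
    have "integral (cbox c d) f = integral (box c d) f"
      by (simp add: integral_open_interval)
    also have "\<dots> = (LINT x|lebesgue_on (box c d). f x)"
    proof (rule lebesgue_integral_eq_integral[symmetric])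
      show "integrable (lebesgue_on (box c d)) f"
        using integrable_mult_indicator[of "box c d" lebesgue f] f by (simp add: integrable_restrict_space)
    qed simp
    also have "\<dots> = (LINT x|lebesgue_on U. indicator (box c d) x * g x)"
      using sub by (subst (1 2) integral_restrict_space)
        (auto intro!: Bochner_Integration.integral_cong simp: f_def indicator_def)
    also have "\<dots> = 0"
      by (rule integral_indicator_box_eq_0[OF g Us that zero])
    finally show ?thesis .
  qed
  \<comment> \<open>Lebesgue differentiation with cubes having \<open>x\<close> as their lower
    corner; \<open>N\<close> is the exceptional null set.\<close>
  obtain N where N: "negligible N"
    "\<And>x e. \<lbrakk>x \<notin> N; 0 < e\<rbrakk> \<Longrightarrow>
      \<exists>\<delta>>0. \<forall>h. 0 < h \<and> h < \<delta> \<longrightarrow>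
        norm (integral (cbox x (x + h *\<^sub>R One)) f /\<^sub>R h ^ DIM(real ^ 'n) - f x) < e"
    using integrable_ccontinuous_explicit[OF fint] by metis
  have "g x = 0" if x: "x \<in> U" "x \<notin> N" for x
  proof (rule ccontr)
    assume "g x \<noteq> 0"
    then have "norm (f x) > 0" using x by (simp add: f_def)
    \<comment> \<open>The tolerance is \<open>norm (f x)\<close> itself: a vanishing average would
      have to be closer to \<open>f x\<close> than 0 is.\<close>
    from N(2)[OF x(2) this] obtain \<delta> where \<delta>: "\<delta> > 0"
      "\<And>h. 0 < h \<Longrightarrow> h < \<delta> \<Longrightarrow>
        norm (integral (cbox x (x + h *\<^sub>R One)) f /\<^sub>R h ^ DIM(real ^ 'n) - f x) < norm (f x)"
      by blast
    obtain c d where cd: "cbox c d \<subseteq> U" "x \<in> box c d"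
      using open_contains_cbox[OF U x(1)] by metis
    have "((\<lambda>h. x + h *\<^sub>R One) \<longlongrightarrow> x + 0 *\<^sub>R One) (at_right 0)"
      by (intro tendsto_intros)
    then have "eventually (\<lambda>h. x + h *\<^sub>R One \<in> box c d) (at_right 0)"
      using cd(2) by (intro topological_tendstoD) auto
    moreover have "eventually (\<lambda>h. 0 < h \<and> h < \<delta>) (at_right 0)"
      using \<delta>(1) by (auto simp: eventually_at_right_field)
    ultimately have "eventually (\<lambda>h. x + h *\<^sub>R One \<in> box c d \<and> 0 < h \<and> h < \<delta>) (at_right 0)"
      by (rule eventually_conj)
    from eventually_happens'[OF trivial_limit_at_right_real this]
    obtain h where h: "x + h *\<^sub>R One \<in> box c d" "0 < h" "h < \<delta>"
      by (elim exE conjE)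
    have "cbox x (x + h *\<^sub>R One) \<subseteq> cbox c d"
      by (rule cbox_subset_cbox_of_box[OF cd(2) h(1)])
    then have "integral (cbox x (x + h *\<^sub>R One)) f = 0"
      using cd(1) by (intro zero') (rule order_trans)
    then show False using \<delta>(2)[OF h(2,3)] by (simp only: scaleR_zero_right) simp
  qed
  then have "AE x in lebesgue. x \<in> U \<longrightarrow> g x = 0"
    using N(1) by (intro AE_I'[of N]) (auto simp: negligible_iff_null_sets)
  then show ?thesis
    by (simp add: AE_restrict_space_iff)
qed

section \<open>Test functions and the algebra of weak gradients\<close>

lemma closure_partial_support:
  "closure {x. partial i f x \<noteq> 0} \<subseteq> closure {x. f x \<noteq> 0}"
proof (rule closure_minimal)
  show "{x. partial i f x \<noteq> 0} \<subseteq> closure {x. f x \<noteq> 0}"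
  proof (rule ccontr)
    assume "\<not> ?thesis"
    then obtain x where x: "partial i f x \<noteq> 0" "x \<in> - closure {x. f x \<noteq> 0}" by auto
    have "eventually (\<lambda>y. y \<in> - closure {x. f x \<noteq> 0}) (nhds x)"
      using x(2) by (intro eventually_nhds_in_open) auto
    then have ev: "eventually (\<lambda>y. f y = 0) (nhds x)"
      by eventually_elim (use closure_subset[of "{x. f x \<noteq> 0}"] in auto)
    have "(f has_derivative (\<lambda>_. 0)) (at x)"
      by (rule has_derivative_transform_eventually[OF has_derivative_const[of 0]])
        (use ev in \<open>auto simp: eventually_at_filter elim!: eventually_mono dest: eventually_nhds_x_imp_x\<close>)
    then show False using x(1) partial_eqI by metis
  qed
qed simp

lemma test_functions_partial:
  assumes "\<psi> \<in> test_functions U"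
  shows "partial i \<psi> \<in> test_functions U"
proof -
  have "compact (closure {x. partial i \<psi> x \<noteq> 0})"
    using assms closure_partial_support[of i \<psi>]
      compact_Int_closed[of "closure {x. \<psi> x \<noteq> 0}" "closure {x. partial i \<psi> x \<noteq> 0}"]
    by (simp add: test_functions_def Int_absorb1 del: compact_closure)
  then show ?thesis
    using assms closure_partial_support[of i \<psi>] by (auto simp: test_functions_def smooth_partial)
qed

lemma test_functions_bounded:
  assumes "\<psi> \<in> test_functions U"
  shows "\<exists>C. \<forall>x. norm (\<psi> x) \<le> C"
proof -
  let ?K = "closure {x. \<psi> x \<noteq> 0}"
  have "compact (\<psi> ` ?K)"
    using assms by (auto simp: test_functions_def
        intro!: compact_continuous_image continuous_on_subset[OF smooth_continuous])
  then obtain C where C: "\<And>y. y \<in> \<psi> ` ?K \<Longrightarrow> norm y \<le> C"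
    using compact_imp_bounded bounded_iff by metis
  have "norm (\<psi> x) \<le> max C 0" for x
  proof (cases "\<psi> x = 0")
    case False
    then have "\<psi> x \<in> \<psi> ` ?K"
      using closure_subset[of "{x. \<psi> x \<noteq> 0}"] by (intro imageI) auto
    from C[OF this] show ?thesis by simp
  qed simp
  then show ?thesis by (intro exI allI)
qed

lemma test_functions_L2:
  assumes "U \<in> lmeasurable" "\<psi> \<in> test_functions U"
  shows "\<psi> \<in> L2 U"
proof -
  obtain C where "\<forall>x. norm (\<psi> x) \<le> C"
    using test_functions_bounded[OF assms(2)] by blast
  then show ?thesis
    using assms by (intro L2_bounded[where C = C])
      (auto simp: test_functions_def fmeasurableD intro!: continuous_imp_measurable_on_sets_lebesgue
        continuous_on_subset[OF smooth_continuous])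
qed

lemma has_weak_gradient_L2: "has_weak_gradient U u G \<Longrightarrow> G \<in> L2 U"
  by (simp add: has_weak_gradient_def)

lemma has_weak_gradientD:
  "has_weak_gradient U u G \<Longrightarrow> \<psi> \<in> test_functions U \<Longrightarrow>
    (LINT x|lebesgue_on U. G x $ i * \<psi> x) = - (LINT x|lebesgue_on U. u x * partial i \<psi> x)"
  by (simp add: has_weak_gradient_def)

text \<open>Tested against any test function, both candidates give the same number, so each
  component of the difference is orthogonal to all test functions. Since \<open>weak_grad\<close> is
  a choice, the pointwise identities for it below all come from here.\<close>

lemma has_weak_gradient_unique:
  assumes U: "open U" "U \<in> lmeasurable"
    and G: "has_weak_gradient U u G" and H: "has_weak_gradient U u H"
  shows "AE x in lebesgue_on U. G x = H x"
proof -
  have "AE x in lebesgue_on U. \<forall>i\<in>UNIV. G x $ i - H x $ i = 0"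
  proof (rule AE_finite_allI)
    fix i :: 'a
    note L = G[THEN has_weak_gradient_L2, THEN L2_vec_nth, of i] H[THEN has_weak_gradient_L2, THEN L2_vec_nth, of i]
    show "AE x in lebesgue_on U. G x $ i - H x $ i = 0"
    proof (rule test_functions_separate[OF U(1)])
      show "integrable (lebesgue_on U) (\<lambda>x. G x $ i - H x $ i)"
        by (intro L2_integrable U L2_diff L)
      fix \<psi> assume \<psi>: "\<psi> \<in> test_functions U"
      have "(LINT x|lebesgue_on U. (G x $ i - H x $ i) * \<psi> x)
          = (LINT x|lebesgue_on U. G x $ i * \<psi> x) - (LINT x|lebesgue_on U. H x $ i * \<psi> x)"
        unfolding left_diff_distrib
        by (intro Bochner_Integration.integral_diff L2_mult_integrable L test_functions_L2[OF U(2) \<psi>])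
      also have "\<dots> = 0"
        by (simp only: has_weak_gradientD[OF G \<psi>] has_weak_gradientD[OF H \<psi>] diff_self)
      finally show "(LINT x|lebesgue_on U. (G x $ i - H x $ i) * \<psi> x) = 0" .
    qed
  qed simp
  then show ?thesis
  proof eventually_elim
    case (elim x)
    then show ?case unfolding vec_eq_iff by auto
  qed
qed

lemma has_weak_gradient_diff:
  assumes U: "U \<in> lmeasurable" and "u \<in> L2 U" "v \<in> L2 U"
    and G: "has_weak_gradient U u G" and H: "has_weak_gradient U v H"
  shows "has_weak_gradient U (\<lambda>x. u x - v x) (\<lambda>x. G x - H x)"
  unfolding has_weak_gradient_def
proof (intro conjI allI ballI)
  show "(\<lambda>x. G x - H x) \<in> L2 U"
    using G H by (intro L2_diff has_weak_gradient_L2)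
next
  fix i \<psi> assume \<psi>: "\<psi> \<in> test_functions U"
  note L = G[THEN has_weak_gradient_L2, THEN L2_vec_nth, of i] H[THEN has_weak_gradient_L2, THEN L2_vec_nth, of i]
  have "(LINT x|lebesgue_on U. (u x - v x) * partial i \<psi> x)
      = (LINT x|lebesgue_on U. u x * partial i \<psi> x) - (LINT x|lebesgue_on U. v x * partial i \<psi> x)"
    unfolding left_diff_distrib
    by (intro Bochner_Integration.integral_diff L2_mult_integrable assms(2,3)
        test_functions_L2[OF U test_functions_partial[OF \<psi>]])
  also have "\<dots> = - ((LINT x|lebesgue_on U. G x $ i * \<psi> x) - (LINT x|lebesgue_on U. H x $ i * \<psi> x))"
    by (simp add: has_weak_gradientD[OF G \<psi>] has_weak_gradientD[OF H \<psi>])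
  also have "(LINT x|lebesgue_on U. G x $ i * \<psi> x) - (LINT x|lebesgue_on U. H x $ i * \<psi> x)
      = (LINT x|lebesgue_on U. (G x - H x) $ i * \<psi> x)"
    unfolding vector_minus_component left_diff_distrib
    by (intro Bochner_Integration.integral_diff[symmetric] L2_mult_integrable L test_functions_L2[OF U \<psi>])
  finally show "(LINT x|lebesgue_on U. (u x - v x) * partial i \<psi> x)
      = - (LINT x|lebesgue_on U. (G x - H x) $ i * \<psi> x)" .
qed

lemma has_weak_gradient_weak_grad: "u \<in> H1 U \<Longrightarrow> has_weak_gradient U u (weak_grad U u)"
  unfolding H1_def weak_grad_def using someI_ex[of "has_weak_gradient U u"] by simp

lemma H1_L2: "u \<in> H1 U \<Longrightarrow> u \<in> L2 U"
  by (simp add: H1_def)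

lemma weak_grad_L2: "u \<in> H1 U \<Longrightarrow> weak_grad U u \<in> L2 U"
  using has_weak_gradient_weak_grad by (auto simp: has_weak_gradient_def)

lemma H1_diff:
  assumes "U \<in> lmeasurable" "u \<in> H1 U" "v \<in> H1 U"
  shows "(\<lambda>x. u x - v x) \<in> H1 U"
  using has_weak_gradient_diff[OF assms(1) assms(2,3)[THEN H1_L2]
      assms(2,3)[THEN has_weak_gradient_weak_grad]]
    L2_diff[OF assms(2,3)[THEN H1_L2]]
  unfolding H1_def by blast

text \<open>Equality can only hold a.e.: the two sides are independently chosen weak gradients of
  the same function.\<close>

lemma weak_grad_diff:
  assumes "open U" "U \<in> lmeasurable" "u \<in> H1 U" "v \<in> H1 U"
  shows "AE x in lebesgue_on U. weak_grad U (\<lambda>x. u x - v x) x = weak_grad U u x - weak_grad U v x"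
  by (rule has_weak_gradient_unique[OF assms(1,2)
      has_weak_gradient_weak_grad[OF H1_diff[OF assms(2-4)]]
      has_weak_gradient_diff[OF assms(2) assms(3,4)[THEN H1_L2] assms(3,4)[THEN has_weak_gradient_weak_grad]]])

subsection \<open>Integration by parts\<close>

lemma has_derivative_along_axis:
  fixes f :: "real ^ 'n \<Rightarrow> complex"
  assumes "\<And>x. f differentiable (at x)"
  shows "((\<lambda>t. f (x + t *\<^sub>R axis i 1)) has_derivative (\<lambda>s. s *\<^sub>R partial i f (x + t *\<^sub>R axis i 1))) (at t)"
proof -
  let ?D = "frechet_derivative f (at (x + t *\<^sub>R axis i 1))"
  have D: "(f has_derivative ?D) (at (x + t *\<^sub>R axis i 1))"
    using assms frechet_derivative_works by blast
  have "((\<lambda>t. x + t *\<^sub>R axis i 1) has_derivative (\<lambda>s. s *\<^sub>R axis i 1)) (at t)"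
    by (auto intro!: derivative_eq_intros)
  from has_derivative_compose[OF this D] show ?thesis
    by (simp add: partial_def linear_scale[OF has_derivative_linear[OF D]])
qed

lemma norm_diff_along_axis_le:
  fixes f :: "real ^ 'n \<Rightarrow> complex"
  assumes f: "\<And>x. f differentiable (at x)" and "0 < h"
    and B: "\<And>t. 0 < t \<Longrightarrow> t < h \<Longrightarrow> norm (partial i f (x + t *\<^sub>R axis i 1)) \<le> B"
  shows "norm (f (x + h *\<^sub>R axis i 1) - f x) \<le> h * B"
proof -
  have "\<exists>t\<in>{0<..<h}. norm (f (x + h *\<^sub>R axis i 1) - f (x + 0 *\<^sub>R axis i 1))
      \<le> norm ((h - 0) *\<^sub>R partial i f (x + t *\<^sub>R axis i 1))"
  proof (rule mvt_general[OF \<open>0 < h\<close>, where f = "\<lambda>t. f (x + t *\<^sub>R axis i 1)"])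
    show "continuous_on {0..h} (\<lambda>t. f (x + t *\<^sub>R axis i 1))"
      by (rule has_derivative_continuous_on, rule has_derivative_at_withinI, rule has_derivative_along_axis[OF f])
  qed (rule has_derivative_along_axis[OF f])
  then obtain t where "t \<in> {0<..<h}" and le: "norm (f (x + h *\<^sub>R axis i 1) - f (x + 0 *\<^sub>R axis i 1))
      \<le> norm ((h - 0) *\<^sub>R partial i f (x + t *\<^sub>R axis i 1))" ..
  then have t: "0 < t" "t < h" by simp_all
  have "norm (f (x + h *\<^sub>R axis i 1) - f x) \<le> h * norm (partial i f (x + t *\<^sub>R axis i 1))"
    using le \<open>0 < h\<close> by simp
  also have "\<dots> \<le> h * B"
    by (rule mult_left_mono[OF B[OF t]]) (use \<open>0 < h\<close> in simp)
  finally show ?thesis .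
qed

lemma difference_quotient_tendsto_partial:
  fixes f :: "real ^ 'n \<Rightarrow> complex"
  assumes "\<And>x. f differentiable (at x)"
  shows "((\<lambda>h. (f (x + h *\<^sub>R axis i 1) - f x) /\<^sub>R h) \<longlongrightarrow> partial i f x) (at 0)"
proof (rule Lim_null[THEN iffD2], rule tendsto_norm_zero_cancel)
  have "((\<lambda>h. norm (f (x + h *\<^sub>R axis i 1) - f x - h *\<^sub>R partial i f x) / norm h) \<longlongrightarrow> 0) (at 0)"
    using has_derivative_along_axis[OF assms, of x i 0] by (simp add: has_derivative_at)
  then show "((\<lambda>h. norm ((f (x + h *\<^sub>R axis i 1) - f x) /\<^sub>R h - partial i f x)) \<longlongrightarrow> 0) (at 0)"
  proof (rule Lim_transform_eventually)
    have "norm (f (x + h *\<^sub>R axis i 1) - f x - h *\<^sub>R partial i f x) / norm h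
        = norm ((f (x + h *\<^sub>R axis i 1) - f x) /\<^sub>R h - partial i f x)" if "h \<noteq> 0" for h
    proof -
      have "(f (x + h *\<^sub>R axis i 1) - f x) /\<^sub>R h - partial i f x
          = (f (x + h *\<^sub>R axis i 1) - f x - h *\<^sub>R partial i f x) /\<^sub>R h"
        using that by (simp add: scaleR_diff_right)
      then show ?thesis by (simp add: divide_inverse mult.commute)
    qed
    then show "\<forall>\<^sub>F h in at 0. norm (f (x + h *\<^sub>R axis i 1) - f x - h *\<^sub>R partial i f x) / norm h
        = norm ((f (x + h *\<^sub>R axis i 1) - f x) /\<^sub>R h - partial i f x)"
      by (auto simp: eventually_at_filter)
  qed
qed

text \<open>Differentiating the constant \<open>\<integral> f (x + h e\<^sub>i)\<close> at \<open>h = 0\<close> takes the place of Fubini's theorem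
  and the fundamental theorem of calculus.\<close>

lemma integral_partial_eq_0:
  fixes f :: "real ^ 'n \<Rightarrow> complex"
  assumes f: "\<And>x. f differentiable (at x)" and f': "continuous_on UNIV (partial i f)"
    and shift: "\<And>h. 0 < h \<Longrightarrow> h < \<delta> \<Longrightarrow>
      integral (cbox a b) (\<lambda>x. f (x + h *\<^sub>R axis i 1)) = integral (cbox a b) f"
    and "\<delta> > 0"
  shows "integral (cbox a b) (partial i f) = 0"
proof (rule LIMSEQ_unique)
  have cont: "continuous_on UNIV f"
    using f by (auto intro!: continuous_at_imp_continuous_on differentiable_imp_continuous_within)
  \<comment> \<open>The steps tend to 0, stay below \<delta>, where shifts are known to preserve the
    integral, and stay below or at 1, so that shifted points remain in
    \<open>cbox a (b + axis i 1)\<close>, on which the derivative is bounded by one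
    constant.\<close>
  define H where "H k = min 1 (\<delta> / 2) * inverse (real (Suc k))" for k
  have H: "0 < H k" "H k \<le> 1" "H k < \<delta>" for k
  proof -
    have "min 1 (\<delta> / 2) * inverse (real (Suc k)) \<le> min 1 (\<delta> / 2) * 1"
      using \<open>\<delta> > 0\<close> by (intro mult_left_mono) (auto simp: divide_simps)
    then show "0 < H k" "H k \<le> 1" "H k < \<delta>"
      using \<open>\<delta> > 0\<close> by (auto simp: H_def)
  qed
  have "H \<longlonglongrightarrow> min 1 (\<delta> / 2) * 0"
    unfolding H_def by (intro tendsto_intros LIMSEQ_inverse_real_of_nat)
  then have Hlim: "filterlim H (at 0) sequentially"
    using H(1) by (simp add: filterlim_at less_imp_neq[THEN not_sym])
  define q where "q k x = (f (x + H k *\<^sub>R axis i 1) - f x) /\<^sub>R H k" for k x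
  have int: "(\<lambda>x. f (x + h *\<^sub>R axis i 1)) integrable_on cbox a b" for h
    by (intro integrable_continuous continuous_on_compose2[OF cont, of _ "\<lambda>x. x + h *\<^sub>R axis i 1"]
        continuous_on_add continuous_on_id continuous_on_const subset_UNIV)
  note int = this this[of 0, simplified]
  have "compact (partial i f ` cbox a (b + axis i 1))"
    by (intro compact_continuous_image continuous_on_subset[OF f'] compact_cbox subset_UNIV)
  from compact_imp_bounded[OF this]
  obtain B where "\<forall>y\<in>partial i f ` cbox a (b + axis i 1). norm y \<le> B"
    unfolding bounded_iff ..
  then have B: "norm (partial i f x) \<le> B" if "x \<in> cbox a (b + axis i 1)" for x
    using that by simp
  show "(\<lambda>k. integral (cbox a b) (q k)) \<longlonglongrightarrow> integral (cbox a b) (partial i f)"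
  proof (rule dominated_convergence(2)[where h = "\<lambda>_. B"])
    show "q k integrable_on cbox a b" for k
      unfolding q_def by (intro integrable_cmul integrable_diff int)
    show "(\<lambda>k. q k x) \<longlonglongrightarrow> partial i f x" for x
      unfolding q_def by (rule filterlim_compose[OF difference_quotient_tendsto_partial[OF f] Hlim])
    show "norm (q k x) \<le> B" if x: "x \<in> cbox a b" for k x
    proof -
      have "norm (f (x + H k *\<^sub>R axis i 1) - f x) \<le> H k * B"
      proof (rule norm_diff_along_axis_le[OF f H(1)])
        fix t assume t: "0 < t" "t < H k"
        have "a $ j \<le> (x + t *\<^sub>R axis i 1) $ j \<and> (x + t *\<^sub>R axis i 1) $ j \<le> (b + axis i 1) $ j" for j
          using x t H(2)[of k] by (cases "j = i") (auto simp: mem_box_cart axis_def dest!: spec[of _ j])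
        then have "x + t *\<^sub>R axis i 1 \<in> cbox a (b + axis i 1)"
          by (intro mem_box_cart(2)[THEN iffD2] allI)
        then show "norm (partial i f (x + t *\<^sub>R axis i 1)) \<le> B" by (rule B)
      qed
      then show ?thesis
        using H(1)[of k] by (simp add: q_def divide_simps mult.commute)
    qed
  qed auto
  \<comment> \<open>Both terms of the difference quotient have the same integral, by invariance
    under the shift.\<close>
  have "integral (cbox a b) (q k) = 0" for k
    unfolding q_def using shift[OF H(1,3)] int by (simp add: Henstock_Kurzweil_Integration.integral_diff)
  then show "(\<lambda>k. integral (cbox a b) (q k)) \<longlonglongrightarrow> 0" by simp
qed

text \<open>Shifting the box by \<open>h\<close> drops a slab at the lower face and gains one at the
  upper face. The two slabs are translates of each other by one period, so their integrals
  cancel.\<close>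

lemma integral_shift_periodic:
  fixes f :: "real ^ 'n \<Rightarrow> complex"
  assumes f: "continuous_on UNIV f"
    and per: "\<And>x. f (x + (b $ i - a $ i) *\<^sub>R axis i 1) = f x"
    and h: "0 < h" "h < b $ i - a $ i"
  shows "integral (cbox a b) (\<lambda>x. f (x + h *\<^sub>R axis i 1)) = integral (cbox a b) f"
proof -
  let ?e = "axis i 1 :: real ^ 'n"
  \<comment> \<open>\<open>c\<close> is the upper corner of the slab that is lost, \<open>d\<close>
    the lower corner of the slab that is gained.\<close>
  define c where "c = (\<chi> j. if j = i then a $ i + h else b $ j)"
  define d where "d = (\<chi> j. if j = i then b $ i else a $ j)"
  have int: "f integrable_on cbox u v" for u v
    by (intro integrable_continuous continuous_on_subset[OF f] subset_UNIV)
  have negl: "negligible {x :: real ^ 'n. x $ i = s}" for s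
    using negligible_standard_hyperplane[of ?e s] by (simp add: inner_axis)
  \<comment> \<open>The constraints on the other coordinates are the same for every box involved;
    splitting them off reduces all box identities to identities between intervals in the coordinate
    \<open>i\<close>.\<close>
  define R where "R x \<longleftrightarrow> (\<forall>j. j \<noteq> i \<longrightarrow> a $ j \<le> x $ j \<and> x $ j \<le> b $ j)" for x :: "real ^ 'n"
  have mem: "x \<in> cbox u v \<longleftrightarrow>
      (\<forall>j. j \<noteq> i \<longrightarrow> u $ j \<le> x $ j \<and> x $ j \<le> v $ j) \<and> u $ i \<le> x $ i \<and> x $ i \<le> v $ i"
    for x u v :: "real ^ 'n"
  proof -
    have "(\<forall>j. P j) \<longleftrightarrow> (\<forall>j. j \<noteq> i \<longrightarrow> P j) \<and> P i" for P :: "'n \<Rightarrow> bool"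
      by metis
    from this[of "\<lambda>j. u $ j \<le> x $ j \<and> x $ j \<le> v $ j"] show ?thesis
      unfolding mem_box_cart(2) .
  qed
  have boxes:
    "x \<in> cbox a b \<longleftrightarrow> R x \<and> a $ i \<le> x $ i \<and> x $ i \<le> b $ i"
    "x \<in> cbox a c \<longleftrightarrow> R x \<and> a $ i \<le> x $ i \<and> x $ i \<le> a $ i + h"
    "x \<in> cbox d (b + h *\<^sub>R ?e) \<longleftrightarrow> R x \<and> b $ i \<le> x $ i \<and> x $ i \<le> b $ i + h"
    "x \<in> cbox a (b + h *\<^sub>R ?e) \<longleftrightarrow> R x \<and> a $ i \<le> x $ i \<and> x $ i \<le> b $ i + h"
    "x \<in> cbox (a + h *\<^sub>R ?e) (b + h *\<^sub>R ?e) \<longleftrightarrow> R x \<and> a $ i + h \<le> x $ i \<and> x $ i \<le> b $ i + h"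
    for x
    unfolding mem R_def by (auto simp: c_def d_def axis_def)
  have "cbox a c \<union> cbox (a + h *\<^sub>R ?e) (b + h *\<^sub>R ?e) = cbox a (b + h *\<^sub>R ?e)"
    using h by (intro set_eqI) (auto simp: boxes)
  moreover have "negligible (cbox a c \<inter> cbox (a + h *\<^sub>R ?e) (b + h *\<^sub>R ?e))"
    by (rule negligible_subset[OF negl[of "a $ i + h"]]) (auto simp: boxes)
  ultimately have "integral (cbox a c) f + integral (cbox (a + h *\<^sub>R ?e) (b + h *\<^sub>R ?e)) f
      = integral (cbox a (b + h *\<^sub>R ?e)) f"
    using integral_Un[OF int int] by metis
  moreover have "integral (cbox a b) f + integral (cbox d (b + h *\<^sub>R ?e)) f
      = integral (cbox a (b + h *\<^sub>R ?e)) f"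
  proof -
    have "cbox a b \<union> cbox d (b + h *\<^sub>R ?e) = cbox a (b + h *\<^sub>R ?e)"
      using h by (intro set_eqI) (auto simp: boxes)
    moreover have "negligible (cbox a b \<inter> cbox d (b + h *\<^sub>R ?e))"
      by (rule negligible_subset[OF negl[of "b $ i"]]) (auto simp: boxes)
    ultimately show ?thesis
      using integral_Un[OF int int] by metis
  qed
  moreover have "integral (cbox d (b + h *\<^sub>R ?e)) f = integral (cbox a c) f"
  proof -
    have eq: "d - (b $ i - a $ i) *\<^sub>R ?e = a" "b + h *\<^sub>R ?e - (b $ i - a $ i) *\<^sub>R ?e = c"
      by (auto simp: vec_eq_iff d_def c_def axis_def)
    have "integral (cbox d (b + h *\<^sub>R ?e)) f
        = integral (cbox a c) (\<lambda>x. f (x + (b $ i - a $ i) *\<^sub>R ?e))"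
      using integral_shift_cbox[of d "(b $ i - a $ i) *\<^sub>R ?e" "b + h *\<^sub>R ?e" f] unfolding eq by simp
    then show ?thesis by (simp only: per)
  qed
  ultimately have "integral (cbox (a + h *\<^sub>R ?e) (b + h *\<^sub>R ?e)) f = integral (cbox a b) f"
    by (metis add.commute add_left_cancel)
  then show ?thesis
    using integral_shift_cbox[of "a + h *\<^sub>R ?e" "h *\<^sub>R ?e" "b + h *\<^sub>R ?e" f] by simp
qed

lemma integral_partial_periodic:
  fixes f :: "real ^ 'n \<Rightarrow> complex"
  assumes "\<And>x. f differentiable (at x)" "continuous_on UNIV (partial i f)"
    and "\<And>x. f (x + (b $ i - a $ i) *\<^sub>R axis i 1) = f x"
    and "a $ i < b $ i"
  shows "integral (cbox a b) (partial i f) = 0"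
proof (rule integral_partial_eq_0[OF assms(1,2)])
  fix h assume "0 < h" "h < b $ i - a $ i"
  then show "integral (cbox a b) (\<lambda>x. f (x + h *\<^sub>R axis i 1)) = integral (cbox a b) f"
    using assms by (intro integral_shift_periodic)
      (auto intro!: continuous_at_imp_continuous_on differentiable_imp_continuous_within)
qed (use assms(4) in simp)

text \<open>A function vanishing outside the open box can be integrated over any larger box. With
  room to spare on every side, small shifts do not change the integral.\<close>

lemma integral_partial_vanishing_outside:
  fixes f :: "real ^ 'n \<Rightarrow> complex"
  assumes f: "\<And>x. f differentiable (at x)" "continuous_on UNIV (partial i f)"
    and zero: "\<And>x. x \<notin> box a b \<Longrightarrow> f x = 0" "\<And>x. x \<notin> box a b \<Longrightarrow> partial i f x = 0"
  shows "integral (cbox a b) (partial i f) = 0"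
proof -
  \<comment> \<open>A margin of 1 on every side, hence invariance for all shifts shorter than
    1.\<close>
  define c d where "c = a - 1" and "d = b + (1 :: real ^ 'n)"
  have super: "integral (cbox u v) g = integral (cbox a b) g"
    if g: "continuous_on UNIV g" "\<And>x. x \<notin> box a b \<Longrightarrow> g x = 0" and uv: "box a b \<subseteq> cbox u v"
    for u v and g :: "real ^ 'n \<Rightarrow> complex"
  proof -
    have "(g has_integral integral (cbox a b) g) (box a b)"
      unfolding has_integral_open_interval
      by (intro integrable_integral integrable_continuous continuous_on_subset[OF g(1)] subset_UNIV)
    from has_integral_on_superset[OF this g(2) uv] show ?thesis by blast
  qed
  have cont: "continuous_on UNIV f"
    using f by (auto intro!: continuous_at_imp_continuous_on differentiable_imp_continuous_within)
  have sub: "box a b \<subseteq> cbox c d"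
  proof
    fix x assume x: "x \<in> box a b"
    have "c $ j \<le> x $ j \<and> x $ j \<le> d $ j" for j
      using x by (auto simp: mem_box_cart c_def d_def dest!: spec[of _ j])
    then show "x \<in> cbox c d" by (simp add: mem_box_cart)
  qed
  have "integral (cbox c d) (partial i f) = 0"
  proof (rule integral_partial_eq_0[OF f])
    fix h :: real assume h: "0 < h" "h < 1"
    have "integral (cbox c d) (\<lambda>x. f (x + h *\<^sub>R axis i 1))
        = integral (cbox (c + h *\<^sub>R axis i 1) (d + h *\<^sub>R axis i 1)) f"
      using integral_shift_cbox[of "c + h *\<^sub>R axis i 1" "h *\<^sub>R axis i 1" "d + h *\<^sub>R axis i 1" f] by simp
    also have "\<dots> = integral (cbox a b) f"
    proof (rule super[OF cont zero(1)])
      show "box a b \<subseteq> cbox (c + h *\<^sub>R axis i 1) (d + h *\<^sub>R axis i 1)"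
      proof
        fix x assume x: "x \<in> box a b"
        have "(c + h *\<^sub>R axis i 1) $ j \<le> x $ j \<and> x $ j \<le> (d + h *\<^sub>R axis i 1) $ j" for j
          using x h by (cases "j = i") (auto simp: mem_box_cart c_def d_def axis_def dest!: spec[of _ j])
        then show "x \<in> cbox (c + h *\<^sub>R axis i 1) (d + h *\<^sub>R axis i 1)"
          by (simp add: mem_box_cart)
      qed
    qed
    also have "\<dots> = integral (cbox c d) f"
      by (rule super[OF cont zero(1) sub, symmetric])
    finally show "integral (cbox c d) (\<lambda>x. f (x + h *\<^sub>R axis i 1)) = integral (cbox c d) f" .
  qed simp
  also have "integral (cbox c d) (partial i f) = integral (cbox a b) (partial i f)"
    by (rule super[OF f(2) zero(2) sub])
  finally show ?thesis .
qed

section \<open>Smooth functions as elements of H^1\<close>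

lemma Ck_cnj: "Ck k f \<Longrightarrow> Ck k (\<lambda>x. cnj (f x))"
proof (induction k arbitrary: f)
  case (Suc k)
  have "(\<lambda>x. cnj (f x)) differentiable (at x)" for x
    using Suc.prems has_derivative_cnj unfolding differentiable_def Ck.simps by blast
  then show ?case
    using Suc by (simp add: partial_cnj)
qed (auto intro: continuous_intros)

lemma smooth_cnj: "smooth f \<Longrightarrow> smooth (\<lambda>x. cnj (f x))"
  by (simp add: smooth_def Ck_cnj)

lemma continuous_L2_box:
  fixes f :: "real ^ 'n \<Rightarrow> 'b::euclidean_space"
  assumes "continuous_on UNIV f"
  shows "f \<in> L2 (box a b)"
proof -
  have "compact (f ` cbox a b)"
    by (intro compact_continuous_image continuous_on_subset[OF assms] compact_cbox subset_UNIV)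
  from compact_imp_bounded[OF this] obtain C where C: "\<forall>y\<in>f ` cbox a b. norm y \<le> C"
    unfolding bounded_iff ..
  have "AE x in lebesgue_on (box a b). norm (f x) \<le> C"
    using C box_subset_cbox[of a b] by (intro AE_I2) (auto simp: space_restrict_space)
  moreover have "f \<in> borel_measurable (lebesgue_on (box a b))"
    by (intro continuous_imp_measurable_on_sets_lebesgue continuous_on_subset[OF assms]) auto
  ultimately show ?thesis
    by (intro L2_bounded) auto
qed

lemma lebesgue_integral_box_eq_integral:
  fixes f :: "real ^ 'n \<Rightarrow> complex"
  assumes "continuous_on UNIV f"
  shows "(LINT x|lebesgue_on (box a b). f x) = integral (cbox a b) f"
  using lebesgue_integral_eq_integral[OF L2_integrable[OF _ continuous_L2_box[OF assms]], of a b]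
  by (simp add: integral_open_interval)

lemma test_functions_vanish:
  assumes "\<psi> \<in> test_functions U" "x \<notin> U"
  shows "\<psi> x = 0"
  using assms closure_subset[of "{x. \<psi> x \<noteq> 0}"] unfolding test_functions_def by auto

text \<open>The function \<open>f\<close> may be arbitrary at the boundary; the product with a test
  function vanishes there together with its derivative, so the derivative of the product integrates
  to 0.\<close>

lemma has_weak_gradient_smooth:
  assumes f: "smooth f"
  shows "has_weak_gradient (box a b) f (\<lambda>x. \<chi> i. partial i f x)"
  unfolding has_weak_gradient_def
proof (intro conjI allI ballI)
  show "(\<lambda>x. \<chi> i. partial i f x) \<in> L2 (box a b)"
    by (intro continuous_L2_box continuous_on_vec_lambda smooth_continuous smooth_partial f)
next
  fix i \<psi> assume \<psi>: "\<psi> \<in> test_functions (box a b)"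
  then have s: "smooth \<psi>" by (simp add: test_functions_def)
  note fs = smooth_continuous[OF f] smooth_continuous[OF s]
    smooth_continuous[OF smooth_partial[OF f, of i]] smooth_continuous[OF smooth_partial[OF s, of i]]
  note L = fs[THEN continuous_L2_box, of a b]
  have eq: "partial i (\<lambda>x. f x * \<psi> x) = (\<lambda>x. f x * partial i \<psi> x + partial i f x * \<psi> x)"
    by (intro partial_mult smooth_differentiable f s)
  have "(LINT x|lebesgue_on (box a b). f x * partial i \<psi> x)
      + (LINT x|lebesgue_on (box a b). partial i f x * \<psi> x)
      = (LINT x|lebesgue_on (box a b). f x * partial i \<psi> x + partial i f x * \<psi> x)"
    by (rule Bochner_Integration.integral_add[symmetric]; rule L2_mult_integrable; rule L)
  also have "\<dots> = integral (cbox a b) (partial i (\<lambda>x. f x * \<psi> x))"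
    unfolding eq
    by (rule lebesgue_integral_box_eq_integral) (intro continuous_on_add continuous_on_mult fs)
  also have "\<dots> = 0"
  proof (rule integral_partial_vanishing_outside)
    show "(\<lambda>x. f x * \<psi> x) differentiable (at x)" for x
      by (intro smooth_differentiable smooth_mult f s)
    show "continuous_on UNIV (partial i (\<lambda>x. f x * \<psi> x))"
      by (intro smooth_continuous smooth_partial smooth_mult f s)
    show "f x * \<psi> x = 0" if "x \<notin> box a b" for x
      using test_functions_vanish[OF \<psi> that] by simp
    show "partial i (\<lambda>x. f x * \<psi> x) x = 0" if "x \<notin> box a b" for x
      using test_functions_vanish[OF \<psi> that] test_functions_vanish[OF test_functions_partial[OF \<psi>] that]
      by (simp add: eq)
  qed
  finally show "(LINT x|lebesgue_on (box a b). f x * partial i \<psi> x)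
      = - (LINT x|lebesgue_on (box a b). (\<chi> i. partial i f x) $ i * \<psi> x)"
    by (simp add: eq_neg_iff_add_eq_0)
qed

lemma smooth_H1: "smooth f \<Longrightarrow> f \<in> H1 (box a b)"
  using has_weak_gradient_smooth continuous_L2_box smooth_continuous
  unfolding H1_def by blast

lemma weak_grad_smooth:
  "smooth f \<Longrightarrow> AE x in lebesgue_on (box a b). weak_grad (box a b) f x = (\<chi> i. partial i f x)"
  by (rule has_weak_gradient_unique[OF open_box _ has_weak_gradient_weak_grad[OF smooth_H1]
        has_weak_gradient_smooth]) auto

subsection \<open>Spaces with boundary conditions\<close>

text \<open>Treats the two approximating classes uniformly, so that each density argument is carried
  out once for both boundary conditions.\<close>

definition trial_functions ::
    "boundary_condition \<Rightarrow> real ^ 'n \<Rightarrow> real ^ 'n \<Rightarrow> (real ^ 'n \<Rightarrow> complex) set"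
  where "trial_functions bc a b =
    (case bc of Dirichlet \<Rightarrow> test_functions (box a b) | Periodic \<Rightarrow> smooth_periodic a b)"

lemma H1_bc_eq: "H1_bc bc a b = H1_closure (box a b) (trial_functions bc a b)"
  by (cases bc) (simp_all add: trial_functions_def)

lemma trial_functions_smooth: "\<psi> \<in> trial_functions bc a b \<Longrightarrow> smooth \<psi>"
  by (cases bc) (simp_all add: trial_functions_def test_functions_def smooth_periodic_def)

lemma test_functions_diff:
  assumes "\<psi> \<in> test_functions U" "\<eta> \<in> test_functions U"
  shows "(\<lambda>x. \<psi> x - \<eta> x) \<in> test_functions U"
proof -
  let ?K = "closure {x. \<psi> x \<noteq> 0} \<union> closure {x. \<eta> x \<noteq> 0}"
  have K: "compact ?K" "?K \<subseteq> U"
    using assms by (auto simp: test_functions_def intro!: compact_Un)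
  have sub: "closure {x. \<psi> x - \<eta> x \<noteq> 0} \<subseteq> ?K"
  proof (rule closure_minimal)
    show "{x. \<psi> x - \<eta> x \<noteq> 0} \<subseteq> ?K"
    proof
      fix x assume "x \<in> {x. \<psi> x - \<eta> x \<noteq> 0}"
      then have "\<psi> x \<noteq> 0 \<or> \<eta> x \<noteq> 0" by auto
      then show "x \<in> ?K"
        using closure_subset[of "{x. \<psi> x \<noteq> 0}"] closure_subset[of "{x. \<eta> x \<noteq> 0}"] by auto
    qed
  qed (intro closed_Un closed_closure)
  have "compact (closure {x. \<psi> x - \<eta> x \<noteq> 0})"
    using compact_Int_closed[OF K(1), of "closure {x. \<psi> x - \<eta> x \<noteq> 0}"] sub
    by (simp add: Int_absorb1 del: compact_closure)
  then show ?thesis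
    using sub K(2) assms unfolding test_functions_def by (auto intro: smooth_diff)
qed

lemma trial_functions_diff:
  assumes "\<psi> \<in> trial_functions bc a b" "\<eta> \<in> trial_functions bc a b"
  shows "(\<lambda>x. \<psi> x - \<eta> x) \<in> trial_functions bc a b"
  using assms by (cases bc)
    (auto simp: trial_functions_def smooth_periodic_def intro: test_functions_diff smooth_diff)

section \<open>The H^1 norm and closedness of the spaces under differences\<close>

lemma H1_norm_sq: "(H1_norm U u)\<^sup>2 = (LINT x|lebesgue_on U. (cmod (u x))\<^sup>2 + (norm (weak_grad U u x))\<^sup>2)"
  unfolding H1_norm_def by (simp add: Bochner_Integration.integral_nonneg)

lemma H1_norm_integrable:
  "u \<in> H1 U \<Longrightarrow> integrable (lebesgue_on U) (\<lambda>x. (cmod (u x))\<^sup>2 + (norm (weak_grad U u x))\<^sup>2)"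
  by (intro Bochner_Integration.integrable_add L2_integrable_norm H1_L2 weak_grad_L2)

text \<open>A pointwise substitute for the triangle inequality; the loss of a factor is harmless for
  closure arguments.\<close>

lemma H1_norm_diff_sq_le:
  assumes U: "open U" "U \<in> lmeasurable" and u: "u \<in> H1 U" and v: "v \<in> H1 U"
  shows "(H1_norm U (\<lambda>x. u x - v x))\<^sup>2 \<le> 2 * (H1_norm U u)\<^sup>2 + 2 * (H1_norm U v)\<^sup>2"
proof -
  have "(LINT x|lebesgue_on U. (cmod (u x - v x))\<^sup>2 + (norm (weak_grad U (\<lambda>x. u x - v x) x))\<^sup>2)
      \<le> (LINT x|lebesgue_on U. 2 * ((cmod (u x))\<^sup>2 + (norm (weak_grad U u x))\<^sup>2)
          + 2 * ((cmod (v x))\<^sup>2 + (norm (weak_grad U v x))\<^sup>2))"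
  proof (rule integral_mono_AE)
    show "AE x in lebesgue_on U. (cmod (u x - v x))\<^sup>2 + (norm (weak_grad U (\<lambda>x. u x - v x) x))\<^sup>2
        \<le> 2 * ((cmod (u x))\<^sup>2 + (norm (weak_grad U u x))\<^sup>2)
          + 2 * ((cmod (v x))\<^sup>2 + (norm (weak_grad U v x))\<^sup>2)"
      using weak_grad_diff[OF U u v]
    proof eventually_elim
      case (elim x)
      then show ?case
        using norm_diff_sq_le[of "u x" "v x"] norm_diff_sq_le[of "weak_grad U u x" "weak_grad U v x"]
        by simp
    qed
  qed (intro H1_norm_integrable H1_diff U u v Bochner_Integration.integrable_add integrable_mult_right)+
  also have "\<dots> = 2 * (H1_norm U u)\<^sup>2 + 2 * (H1_norm U v)\<^sup>2"
    unfolding H1_norm_sq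
    by (subst Bochner_Integration.integral_add)
      (intro integrable_mult_right H1_norm_integrable u v | simp only: integral_mult_right_zero)+
  finally show ?thesis by (simp add: H1_norm_sq)
qed

lemma H1_closure_diff:
  assumes U: "open U" "U \<in> lmeasurable"
    and D: "\<And>\<psi> \<eta>. \<psi> \<in> D \<Longrightarrow> \<eta> \<in> D \<Longrightarrow> (\<lambda>x. \<psi> x - \<eta> x) \<in> D"
    and u: "u \<in> H1_closure U D" and v: "v \<in> H1_closure U D"
  shows "(\<lambda>x. u x - v x) \<in> H1_closure U D"
proof -
  have uH: "u \<in> H1 U" and vH: "v \<in> H1 U"
    using u v by (auto simp: H1_closure_def)
  have "\<exists>\<theta>\<in>D. \<theta> \<in> H1 U \<and> H1_norm U (\<lambda>x. (u x - v x) - \<theta> x) < \<epsilon>" if "\<epsilon> > 0" for \<epsilon>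
  proof -
    \<comment> \<open>Two errors below \<open>\<epsilon>/2\<close> suffice in spite of the factor 2,
      since \<open>2 (\<epsilon>/2)^2 + 2 (\<epsilon>/2)^2 = \<epsilon>^2\<close>.\<close>
    obtain \<psi> where \<psi>: "\<psi> \<in> D" "\<psi> \<in> H1 U" "H1_norm U (\<lambda>x. u x - \<psi> x) < \<epsilon> / 2"
      using u \<open>\<epsilon> > 0\<close> half_gt_zero unfolding H1_closure_def by blast
    obtain \<eta> where \<eta>: "\<eta> \<in> D" "\<eta> \<in> H1 U" "H1_norm U (\<lambda>x. v x - \<eta> x) < \<epsilon> / 2"
      using v \<open>\<epsilon> > 0\<close> half_gt_zero unfolding H1_closure_def by blast
    have nn: "0 \<le> H1_norm U w" for w
      by (simp add: H1_norm_def Bochner_Integration.integral_nonneg)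
    have eq: "(\<lambda>x. (u x - v x) - (\<psi> x - \<eta> x)) = (\<lambda>x. (u x - \<psi> x) - (v x - \<eta> x))"
      by (simp add: algebra_simps)
    have "(H1_norm U (\<lambda>x. (u x - \<psi> x) - (v x - \<eta> x)))\<^sup>2
        \<le> 2 * (H1_norm U (\<lambda>x. u x - \<psi> x))\<^sup>2 + 2 * (H1_norm U (\<lambda>x. v x - \<eta> x))\<^sup>2"
      by (intro H1_norm_diff_sq_le U H1_diff uH vH \<psi>(2) \<eta>(2))
    also have "\<dots> < 2 * (\<epsilon> / 2)\<^sup>2 + 2 * (\<epsilon> / 2)\<^sup>2"
      by (intro add_strict_mono mult_strict_left_mono power_strict_mono \<psi>(3) \<eta>(3) nn) auto
    also have "\<dots> = \<epsilon>\<^sup>2"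
      by (simp add: power2_eq_square)
    finally have "H1_norm U (\<lambda>x. (u x - v x) - (\<psi> x - \<eta> x)) < \<epsilon>"
      unfolding eq using \<open>\<epsilon> > 0\<close> by (auto intro: power2_less_imp_less)
    then show ?thesis
      using D[OF \<psi>(1) \<eta>(1)] H1_diff[OF U(2) \<psi>(2) \<eta>(2)] by (intro bexI[of _ "\<lambda>x. \<psi> x - \<eta> x"] conjI)
  qed
  then show ?thesis
    using H1_diff[OF U(2) uH vH] by (simp add: H1_closure_def)
qed

text \<open>Makes the increment between two time steps admissible as a test function in the weak
  equation.\<close>

lemma H1_bc_diff:
  "u \<in> H1_bc bc a b \<Longrightarrow> v \<in> H1_bc bc a b \<Longrightarrow> (\<lambda>x. u x - v x) \<in> H1_bc bc a b"
  unfolding H1_bc_eq by (rule H1_closure_diff[OF open_box]) (auto intro: trial_functions_diff)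

lemma H1_bc_H1: "u \<in> H1_bc bc a b \<Longrightarrow> u \<in> H1 (box a b)"
  by (simp add: H1_bc_eq H1_closure_def)

subsection \<open>Symmetry of the angular momentum operator\<close>

text \<open>For \<open>i \<noteq> l\<close> the weight does not depend on the coordinate
  \<open>i\<close>, so the integrand is the exact derivative of the weighted product. The weight is
  not periodic in its own direction, but only periodicity in direction \<open>i\<close> is used,
  where it is constant.\<close>

lemma integral_weighted_partial_trial:
  fixes i l :: "'n::finite"
  assumes \<psi>: "\<psi> \<in> trial_functions bc a b" and \<eta>: "\<eta> \<in> trial_functions bc a b"
    and il: "i \<noteq> l" and ab: "a $ i < b $ i"
  shows "(LINT x|lebesgue_on (box a b).
      of_real (x $ l) * (\<psi> x * cnj (partial i \<eta> x) + partial i \<psi> x * cnj (\<eta> x))) = 0"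
proof -
  note s = trial_functions_smooth[OF \<psi>] trial_functions_smooth[OF \<eta>]
  define g where "g x = \<psi> x * cnj (\<eta> x)" for x
  define f where "f x = of_real (x $ l) * g x" for x
  have sg: "smooth g"
    unfolding g_def by (intro smooth_mult smooth_cnj s)
  have pg: "partial i g = (\<lambda>x. \<psi> x * cnj (partial i \<eta> x) + partial i \<psi> x * cnj (\<eta> x))"
    unfolding g_def using s smooth_cnj[OF s(2)]
    by (simp add: partial_mult partial_cnj smooth_differentiable)
  have xl: "((\<lambda>x :: real ^ 'n. complex_of_real (x $ l)) has_derivative (\<lambda>h. of_real (h $ l))) (at x)" for x
    by (intro has_derivative_of_real bounded_linear.has_derivative[OF bounded_linear_vec_nth] has_derivative_ident)
  have xl_diff: "(\<lambda>x :: real ^ 'n. complex_of_real (x $ l)) differentiable (at x)" for x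
    using xl differentiable_def by blast
  have pxl: "partial i (\<lambda>x :: real ^ 'n. complex_of_real (x $ l)) = (\<lambda>x. 0)"
    using il by (simp add: fun_eq_iff partial_eqI[OF xl] axis_def)
  have f: "f differentiable (at x)" for x
    unfolding f_def by (intro differentiable_mult xl_diff smooth_differentiable[OF sg])
  have pf: "partial i f = (\<lambda>x. of_real (x $ l) * partial i g x)"
    unfolding f_def by (subst partial_mult) (simp_all add: xl_diff smooth_differentiable[OF sg] pxl)
  have cf: "continuous_on UNIV (partial i f)"
    unfolding pf by (intro continuous_on_mult continuous_on_of_real smooth_continuous[OF smooth_partial[OF sg]]
      linear_continuous_on bounded_linear_vec_nth)
  have "integral (cbox a b) (partial i f) = 0"
  proof (cases bc)
    case Dirichlet
    then have "\<psi> \<in> test_functions (box a b)"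
      using \<psi> by (simp add: trial_functions_def)
    from test_functions_vanish[OF this] test_functions_vanish[OF test_functions_partial[OF this]]
    show ?thesis
      by (intro integral_partial_vanishing_outside f cf) (simp_all add: f_def g_def pf pg)
  next
    case Periodic
    then have per: "\<psi> (x + axis i (b $ i - a $ i)) = \<psi> x" "\<eta> (x + axis i (b $ i - a $ i)) = \<eta> x" for x
      using \<psi> \<eta> by (auto simp: trial_functions_def smooth_periodic_def)
    have ax: "(b $ i - a $ i) *\<^sub>R axis i 1 = axis i (b $ i - a $ i)"
      by (simp add: vec_eq_iff axis_def)
    show ?thesis
      by (intro integral_partial_periodic f cf ab) (use il in \<open>simp add: f_def g_def ax per, simp add: axis_def\<close>)
  qed
  then show ?thesis
    using lebesgue_integral_box_eq_integral[OF cf, of a b] by (simp add: pf pg)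
qed

text \<open>\<open>boundary_form U l k u v\<close> is \<open>\<integral> x\<^sub>l \<partial>\<^sub>k (u v\<^sup>*)\<close>, i.e. the boundary term that arises when the
  summand \<open>x\<^sub>l \<partial>\<^sub>k\<close> of \<open>L\<^sub>z\<close> is moved from one factor to the other.\<close>

definition boundary_form ::
    "(real ^ 'n) set \<Rightarrow> 'n \<Rightarrow> 'n \<Rightarrow> (real ^ 'n \<Rightarrow> complex) \<Rightarrow> (real ^ 'n \<Rightarrow> complex) \<Rightarrow> complex"
  where "boundary_form U l k u v = (LINT x|lebesgue_on U.
    of_real (x $ l) * (u x * cnj (weak_grad U v x $ k) + weak_grad U u x $ k * cnj (v x)))"

section \<open>The boundary form: integrability, continuity and vanishing\<close>

lemma bounded_coordinate:
  fixes U :: "(real ^ 'n) set"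
  assumes "bounded U"
  obtains M where "M > 0" "\<And>x. x \<in> U \<Longrightarrow> \<bar>x $ l\<bar> \<le> M"
proof -
  obtain M where "M > 0" "\<forall>x\<in>U. norm x \<le> M"
    using assms bounded_pos by metis
  then show ?thesis
    using component_le_norm_cart[of _ l] order_trans by (intro that[of M]) blast+
qed

lemma L2_mult_coordinate:
  fixes f :: "real ^ 'n \<Rightarrow> complex"
  assumes U: "bounded U" "U \<in> sets lebesgue" and f: "f \<in> L2 U"
  shows "(\<lambda>x. of_real (x $ l) * f x) \<in> L2 U"
proof -
  obtain M where M: "\<And>x. x \<in> U \<Longrightarrow> \<bar>x $ l\<bar> \<le> M"
    using bounded_coordinate[OF U(1)] by metis
  show ?thesis
  proof (rule L2_mult_bounded[OF f])
    show "(\<lambda>x. complex_of_real (x $ l)) \<in> borel_measurable (lebesgue_on U)"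
      by (intro continuous_imp_measurable_on_sets_lebesgue U(2) continuous_on_of_real
          linear_continuous_on bounded_linear_vec_nth)
    show "AE x in lebesgue_on U. norm (complex_of_real (x $ l)) \<le> M"
      using M by (intro AE_I2) (simp add: space_restrict_space)
  qed
qed

lemma boundary_form_integrable:
  fixes U :: "(real ^ 'n) set"
  assumes U: "bounded U" "U \<in> sets lebesgue" and u: "u \<in> H1 U" and v: "v \<in> H1 U"
  shows "integrable (lebesgue_on U) (\<lambda>x.
    of_real (x $ l) * (u x * cnj (weak_grad U v x $ k) + weak_grad U u x $ k * cnj (v x)))"
proof -
  note L = H1_L2[OF u] L2_vec_nth[OF weak_grad_L2[OF u], of k]
    L2_cnj[OF H1_L2[OF v]] L2_cnj[OF L2_vec_nth[OF weak_grad_L2[OF v], of k]]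
  have "integrable (lebesgue_on U) (\<lambda>x. (of_real (x $ l) * u x) * cnj (weak_grad U v x $ k)
      + (of_real (x $ l) * weak_grad U u x $ k) * cnj (v x))"
    by (intro Bochner_Integration.integrable_add L2_mult_integrable L2_mult_coordinate[OF U] L)
  then show ?thesis by (simp add: algebra_simps)
qed

lemma boundary_form_diff_left:
  fixes U :: "(real ^ 'n) set"
  assumes U: "open U" "bounded U" and u: "u \<in> H1 U" and u': "u' \<in> H1 U" and v: "v \<in> H1 U"
  shows "boundary_form U l k (\<lambda>x. u x - u' x) v = boundary_form U l k u v - boundary_form U l k u' v"
proof -
  have U': "U \<in> lmeasurable" "U \<in> sets lebesgue"
    using U by (auto intro: bounded_set_imp_lmeasurable)
  note I = boundary_form_integrable[OF U(2) U'(2) _ v, of _ l k]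
  have "boundary_form U l k (\<lambda>x. u x - u' x) v = (LINT x|lebesgue_on U.
      of_real (x $ l) * (u x * cnj (weak_grad U v x $ k) + weak_grad U u x $ k * cnj (v x))
      - of_real (x $ l) * (u' x * cnj (weak_grad U v x $ k) + weak_grad U u' x $ k * cnj (v x)))"
    unfolding boundary_form_def
  proof (rule integral_cong_AE)
    show "AE x in lebesgue_on U.
      of_real (x $ l) * ((u x - u' x) * cnj (weak_grad U v x $ k)
        + weak_grad U (\<lambda>x. u x - u' x) x $ k * cnj (v x))
      = of_real (x $ l) * (u x * cnj (weak_grad U v x $ k) + weak_grad U u x $ k * cnj (v x))
      - of_real (x $ l) * (u' x * cnj (weak_grad U v x $ k) + weak_grad U u' x $ k * cnj (v x))"
      using weak_grad_diff[OF U(1) U'(1) u u']     proof eventually_elim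
        case (elim x)
        show ?case unfolding elim by (simp add: algebra_simps)
      qed
  qed (intro borel_measurable_integrable Bochner_Integration.integrable_diff I H1_diff U'(1) u u')+
  also have "\<dots> = boundary_form U l k u v - boundary_form U l k u' v"
    unfolding boundary_form_def by (rule Bochner_Integration.integral_diff[OF I[OF u] I[OF u']])
  finally show ?thesis .
qed

text \<open>Hermitian symmetry lets a density argument in the first slot serve for the second slot
  too.\<close>

lemma boundary_form_commute: "boundary_form U l k v u = cnj (boundary_form U l k u v)"
  unfolding boundary_form_def Bochner_Integration.integral_cnj[symmetric]
  by (rule Bochner_Integration.integral_cong) (simp_all add: algebra_simps)

text \<open>Young's inequality. A large weight exploits the smallness of one factor in the density
  argument; the weight 1 serves the rotation estimate.\<close>

lemma two_mult_le_weighted: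
  fixes p q t :: real
  assumes "t > 0"
  shows "2 * (p * q) \<le> t * p\<^sup>2 + q\<^sup>2 / t"
proof -
  have "0 \<le> (t * p - q)\<^sup>2 / t"
    using assms by simp
  also have "\<dots> = t * p\<^sup>2 + q\<^sup>2 / t - 2 * (p * q)"
    using assms by (simp add: power2_eq_square field_simps)
  finally show ?thesis by simp
qed

text \<open>Takes the place of a Cauchy-Schwarz bound by the product of the two H^1 norms: the free
  weight \<open>t\<close> later balances a small first argument against a fixed second one.\<close>

lemma norm_boundary_form_le:
  fixes U :: "(real ^ 'n) set"
  assumes U: "bounded U" "U \<in> sets lebesgue" and u: "u \<in> H1 U" and v: "v \<in> H1 U"
    and M: "M \<ge> 0" "\<And>x. x \<in> U \<Longrightarrow> \<bar>x $ l\<bar> \<le> M" and t: "t > 0"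
  shows "norm (boundary_form U l k u v) \<le> M * (t * (H1_norm U u)\<^sup>2 + (H1_norm U v)\<^sup>2 / t)"
proof -
  let ?N = "\<lambda>u x. (cmod (u x))\<^sup>2 + (norm (weak_grad U u x))\<^sup>2"
  have "norm (boundary_form U l k u v) \<le> (LINT x|lebesgue_on U. M * (t * ?N u x + ?N v x / t))"
    unfolding boundary_form_def
  proof (rule Bochner_Integration.integral_norm_bound_integral)
    show "integrable (lebesgue_on U) (\<lambda>x. M * (t * ?N u x + ?N v x / t))"
      by (intro integrable_mult_right Bochner_Integration.integrable_add integrable_divide
          H1_norm_integrable u v)
    fix x assume x: "x \<in> space (lebesgue_on U)"
    let ?p = "cmod (u x)" and ?q = "cmod (v x)"
    let ?P = "norm (weak_grad U u x)" and ?Q = "norm (weak_grad U v x)"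
    have "norm (u x * cnj (weak_grad U v x $ k) + weak_grad U u x $ k * cnj (v x))
        \<le> ?p * cmod (weak_grad U v x $ k) + cmod (weak_grad U u x $ k) * ?q"
      by (rule order_trans[OF norm_triangle_ineq]) (simp add: norm_mult)
    also have "\<dots> \<le> ?p * ?Q + ?P * ?q"
      by (intro add_mono mult_left_mono mult_right_mono Finite_Cartesian_Product.norm_nth_le norm_ge_zero)
    also have "\<dots> \<le> t * ?N u x + ?N v x / t"
    proof -
      have "0 \<le> t * ?N u x + ?N v x / t"
        using t by simp
      then show ?thesis
        using two_mult_le_weighted[OF t, of ?p ?Q] two_mult_le_weighted[OF t, of ?P ?q]
        by (simp add: add_divide_distrib distrib_left)
    qed
    finally have "norm (u x * cnj (weak_grad U v x $ k) + weak_grad U u x $ k * cnj (v x))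
        \<le> t * ?N u x + ?N v x / t" .
    moreover have "\<bar>x $ l\<bar> \<le> M"
      using x M(2) by (simp add: space_restrict_space)
    ultimately show "norm (of_real (x $ l)
          * (u x * cnj (weak_grad U v x $ k) + weak_grad U u x $ k * cnj (v x)))
        \<le> M * (t * ?N u x + ?N v x / t)"
      unfolding norm_mult norm_of_real by (intro mult_mono M(1) norm_ge_zero)
  qed (rule boundary_form_integrable[OF U u v])
  also have "\<dots> = M * (t * (H1_norm U u)\<^sup>2 + (H1_norm U v)\<^sup>2 / t)"
    unfolding H1_norm_sq integral_mult_right_zero
    by (subst Bochner_Integration.integral_add)
      (intro integrable_mult_right integrable_divide H1_norm_integrable u v
        | simp only: integral_mult_right_zero integral_divide_zero)+
  finally show ?thesis .
qed

lemma boundary_form_closure: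
  fixes U :: "(real ^ 'n) set"
  assumes U: "open U" "bounded U" and u: "u \<in> H1_closure U D" and v: "v \<in> H1 U"
    and D: "\<And>\<psi>. \<psi> \<in> D \<Longrightarrow> \<psi> \<in> H1 U \<Longrightarrow> boundary_form U l k \<psi> v = 0"
  shows "boundary_form U l k u v = 0"
proof -
  have U': "U \<in> lmeasurable" "U \<in> sets lebesgue"
    using U by (auto intro: bounded_set_imp_lmeasurable)
  have uH: "u \<in> H1 U" using u by (simp add: H1_closure_def)
  obtain M where M: "M > 0" "\<And>x. x \<in> U \<Longrightarrow> \<bar>x $ l\<bar> \<le> M"
    using bounded_coordinate[OF U(2)] by metis
  define C where "C = M * (1 + (H1_norm U v)\<^sup>2)"
  have bound: "norm (boundary_form U l k u v) \<le> \<epsilon> * C" if "\<epsilon> > 0" for \<epsilon>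
  proof -
    have "\<exists>\<psi>\<in>D. \<psi> \<in> H1 U \<and> H1_norm U (\<lambda>x. u x - \<psi> x) < \<epsilon>"
      using u that by (simp add: H1_closure_def)
    then obtain \<psi> where \<psi>: "\<psi> \<in> D" "\<psi> \<in> H1 U" "H1_norm U (\<lambda>x. u x - \<psi> x) < \<epsilon>"
      by (elim bexE conjE)
    have nn: "0 \<le> H1_norm U w" for w
      by (simp add: H1_norm_def Bochner_Integration.integral_nonneg)
    have "boundary_form U l k u v = boundary_form U l k (\<lambda>x. u x - \<psi> x) v"
      using boundary_form_diff_left[OF U uH \<psi>(2) v, of l k] D[OF \<psi>(1,2)] by simp
    \<comment> \<open>With an approximation error below \<epsilon>, the weight
      \<open>1/\<epsilon>\<close> makes both summands of order \<epsilon>; this is also the origin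
      of the constant \<open>C\<close>.\<close>
    also have "norm \<dots> \<le> M * (1 / \<epsilon> * (H1_norm U (\<lambda>x. u x - \<psi> x))\<^sup>2 + (H1_norm U v)\<^sup>2 / (1 / \<epsilon>))"
      by (rule norm_boundary_form_le[OF U(2) U'(2) H1_diff[OF U'(1) uH \<psi>(2)] v])
        (use M that in auto)
    also have "\<dots> \<le> M * (1 / \<epsilon> * \<epsilon>\<^sup>2 + (H1_norm U v)\<^sup>2 / (1 / \<epsilon>))"
      using that M(1) power_mono[OF less_imp_le[OF \<psi>(3)] nn, of 2]
      by (intro mult_left_mono add_right_mono) auto
    also have "\<dots> = \<epsilon> * C"
      using that by (simp add: C_def power2_eq_square algebra_simps)
    finally show ?thesis .
  qed
  have "norm (boundary_form U l k u v) \<le> 0"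
  proof (rule field_le_epsilon)
    fix e :: real assume "e > 0"
    have "C > 0" using M(1) by (simp add: C_def add_pos_nonneg)
    then show "norm (boundary_form U l k u v) \<le> 0 + e"
      using bound[of "e / C"] \<open>e > 0\<close> by simp
  qed
  then show ?thesis by simp
qed

lemma boundary_form_trial_eq_0:
  assumes \<psi>: "\<psi> \<in> trial_functions bc a b" and \<eta>: "\<eta> \<in> trial_functions bc a b"
    and "k \<noteq> l" and "a $ k < b $ k"
  shows "boundary_form (box a b) l k \<psi> \<eta> = 0"
proof -
  note s = trial_functions_smooth[OF \<psi>] trial_functions_smooth[OF \<eta>]
  have "boundary_form (box a b) l k \<psi> \<eta> = (LINT x|lebesgue_on (box a b).
      of_real (x $ l) * (\<psi> x * cnj (partial k \<eta> x) + partial k \<psi> x * cnj (\<eta> x)))"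
    unfolding boundary_form_def
  proof (rule integral_cong_AE)
    show "AE x in lebesgue_on (box a b).
      of_real (x $ l) * (\<psi> x * cnj (weak_grad (box a b) \<eta> x $ k) + weak_grad (box a b) \<psi> x $ k * cnj (\<eta> x))
      = of_real (x $ l) * (\<psi> x * cnj (partial k \<eta> x) + partial k \<psi> x * cnj (\<eta> x))"
      using weak_grad_smooth[OF s(1)] weak_grad_smooth[OF s(2)] by eventually_elim simp
    show "(\<lambda>x. of_real (x $ l) * (\<psi> x * cnj (weak_grad (box a b) \<eta> x $ k)
        + weak_grad (box a b) \<psi> x $ k * cnj (\<eta> x))) \<in> borel_measurable (lebesgue_on (box a b))"
      by (intro borel_measurable_integrable boundary_form_integrable smooth_H1 s) auto
    show "(\<lambda>x. of_real (x $ l) * (\<psi> x * cnj (partial k \<eta> x) + partial k \<psi> x * cnj (\<eta> x)))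
        \<in> borel_measurable (lebesgue_on (box a b))"
      by (intro L2_measurable[OF continuous_L2_box] continuous_on_mult continuous_on_add continuous_on_cnj
          continuous_on_of_real smooth_continuous smooth_partial s linear_continuous_on bounded_linear_vec_nth)
  qed
  also have "\<dots> = 0"
    by (rule integral_weighted_partial_trial[OF assms])
  finally show ?thesis .
qed

text \<open>Density is applied one slot at a time: the first argument is approximated against a
  trial function, and then the roles are exchanged by Hermitian symmetry.\<close>

lemma boundary_form_bc_eq_0:
  assumes u: "u \<in> H1_bc bc a b" and v: "v \<in> H1_bc bc a b" and kl: "k \<noteq> l" "a $ k < b $ k"
  shows "boundary_form (box a b) l k u v = 0"
proof -
  have *: "boundary_form (box a b) l k w \<eta> = 0"
    if "w \<in> H1_bc bc a b" "\<eta> \<in> trial_functions bc a b" for w \<eta>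
    by (rule boundary_form_closure[OF open_box bounded_box that(1)[unfolded H1_bc_eq]
          smooth_H1[OF trial_functions_smooth[OF that(2)]]])
      (rule boundary_form_trial_eq_0[OF _ that(2) kl])
  show ?thesis
  proof (rule boundary_form_closure[OF open_box bounded_box u[unfolded H1_bc_eq] H1_bc_H1[OF v]])
    fix \<psi> assume "\<psi> \<in> trial_functions bc a b"
    from *[OF v this] show "boundary_form (box a b) l k \<psi> v = 0"
      by (subst boundary_form_commute) simp
  qed
qed

section \<open>Pairings in L^2 and symmetry of the rotation operator\<close>

definition ip :: "(real ^ 'n) set \<Rightarrow> (real ^ 'n \<Rightarrow> complex) \<Rightarrow> (real ^ 'n \<Rightarrow> complex) \<Rightarrow> complex"
  where "ip U f g = (LINT x|lebesgue_on U. f x * cnj (g x))"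

lemma ip_integrable:
  assumes "f \<in> L2 U" "g \<in> L2 U"
  shows "integrable (lebesgue_on U) (\<lambda>x. f x * cnj (g x))"
  by (rule L2_mult_integrable[OF assms(1) L2_cnj[OF assms(2)]])

lemma ip_commute: "ip U g f = cnj (ip U f g)"
  unfolding ip_def Bochner_Integration.integral_cnj[symmetric]
  by (rule Bochner_Integration.integral_cong) (simp_all add: mult.commute)

lemma ip_add_left:
  assumes "f \<in> L2 U" "g \<in> L2 U" "h \<in> L2 U"
  shows "ip U (\<lambda>x. f x + g x) h = ip U f h + ip U g h"
  unfolding ip_def distrib_right by (intro Bochner_Integration.integral_add ip_integrable assms)

lemma ip_add_right:
  assumes "f \<in> L2 U" "g \<in> L2 U" "h \<in> L2 U"
  shows "ip U h (\<lambda>x. f x + g x) = ip U h f + ip U h g"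
  using ip_add_left[OF assms] by (metis complex_cnj_add ip_commute)

lemma ip_cong_AE:
  assumes "AE x in lebesgue_on U. f x = f' x" "AE x in lebesgue_on U. g x = g' x"
    and "f \<in> L2 U" "f' \<in> L2 U" "g \<in> L2 U" "g' \<in> L2 U"
  shows "ip U f g = ip U f' g'"
  unfolding ip_def
proof (rule integral_cong_AE)
  show "AE x in lebesgue_on U. f x * cnj (g x) = f' x * cnj (g' x)"
    using assms(1,2) by eventually_elim simp
qed (intro borel_measurable_integrable ip_integrable assms)+

lemma ip_self_eq: "ip U f f = of_real (LINT x|lebesgue_on U. (cmod (f x))\<^sup>2)"
  unfolding ip_def complex_norm_square[symmetric] by (rule integral_complex_of_real)

lemma L2_cmult: "f \<in> L2 U \<Longrightarrow> (\<lambda>x. c * f x) \<in> L2 U" for f :: "real ^ 'n \<Rightarrow> complex"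
  by (rule L2_mult_bounded[where C = "norm c"]) auto

lemma Lz_L2:
  fixes U :: "(real ^ 'n) set"
  assumes U: "bounded U" "U \<in> sets lebesgue" and u: "u \<in> H1 U"
  shows "Lz \<iota> U u \<in> L2 U"
proof (cases "CARD('n) \<ge> 2")
  case True
  have "(\<lambda>x. \<i> * (of_real (x $ \<iota> 2) * weak_grad U u x $ \<iota> 1 - of_real (x $ \<iota> 1) * weak_grad U u x $ \<iota> 2)) \<in> L2 U"
    by (intro L2_cmult L2_diff L2_mult_coordinate[OF U] L2_vec_nth weak_grad_L2 u)
  then show ?thesis
    using True by (simp add: Lz_def[abs_def])
next
  case False
  have "(\<lambda>x. 0 * u x) \<in> L2 U"
    by (intro L2_cmult H1_L2 u)
  then show ?thesis
    using False by (simp add: Lz_def[abs_def])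
qed

lemma Lz_diff:
  assumes "open U" "U \<in> lmeasurable" "u \<in> H1 U" "v \<in> H1 U"
  shows "AE x in lebesgue_on U. Lz \<iota> U (\<lambda>x. u x - v x) x = Lz \<iota> U u x - Lz \<iota> U v x"
  using weak_grad_diff[OF assms]
proof eventually_elim
  case (elim x)
  show ?case unfolding Lz_def elim by (simp add: algebra_simps)
qed

text \<open>Conjugating the factor \<i> supplies the sign that integration by parts would produce,
  so the two sides differ by a combination of two boundary forms. In each of them the weight and the
  derivative belong to different coordinates, so both vanish.\<close>

lemma Lz_symmetric:
  fixes \<iota> :: "nat \<Rightarrow> 'n::finite" and a b :: "real ^ 'n"
  defines "U \<equiv> box a b"
  assumes inj: "inj_on \<iota> {1..CARD('n)}" and ab: "\<And>i. a $ i < b $ i"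
    and u: "u \<in> H1_bc bc a b" and v: "v \<in> H1_bc bc a b"
  shows "ip U (Lz \<iota> U u) v = cnj (ip U (Lz \<iota> U v) u)"
proof (cases "CARD('n) \<ge> 2")
  case True
  let ?k = "\<iota> 1" and ?l = "\<iota> 2"
  have kl: "?k \<noteq> ?l"
    using inj_onD[OF inj, of 1 2] True by auto
  have U: "bounded U" "U \<in> sets lebesgue" by (simp_all add: U_def)
  have H: "u \<in> H1 U" "v \<in> H1 U"
    using u v by (simp_all add: U_def H1_bc_H1)
  note L = H1_L2[OF H(1)] H1_L2[OF H(2)] Lz_L2[OF U H(1), of \<iota>] Lz_L2[OF U H(2), of \<iota>]
  have "ip U (Lz \<iota> U u) v - cnj (ip U (Lz \<iota> U v) u) = ip U (Lz \<iota> U u) v - ip U u (Lz \<iota> U v)"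
    using ip_commute[of U u "Lz \<iota> U v"] by simp
  also have "\<dots> = (LINT x|lebesgue_on U. Lz \<iota> U u x * cnj (v x) - u x * cnj (Lz \<iota> U v x))"
    unfolding ip_def by (rule Bochner_Integration.integral_diff[symmetric]; rule ip_integrable; rule L)
  also have "\<dots> = (LINT x|lebesgue_on U.
      \<i> * (of_real (x $ ?l) * (u x * cnj (weak_grad U v x $ ?k) + weak_grad U u x $ ?k * cnj (v x))
        - of_real (x $ ?k) * (u x * cnj (weak_grad U v x $ ?l) + weak_grad U u x $ ?l * cnj (v x))))"
    using True by (intro Bochner_Integration.integral_cong) (simp_all add: Lz_def algebra_simps)
  also have "\<dots> = \<i> * (boundary_form U ?l ?k u v - boundary_form U ?k ?l u v)"
    unfolding boundary_form_def integral_mult_right_zero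
    by (subst Bochner_Integration.integral_diff) (rule boundary_form_integrable[OF U H] refl)+
  also have "\<dots> = 0"
    using boundary_form_bc_eq_0[OF u v kl ab] boundary_form_bc_eq_0[OF u v kl[symmetric] ab]
    by (simp add: U_def)
  finally show ?thesis by simp
next
  case False
  then show ?thesis by (simp add: Lz_def[abs_def] ip_def)
qed

text \<open>As a sum of scalar pairings it inherits their laws componentwise;
  \<open>ip_vec_eq\<close> returns to the single integral that occurs in the weak equation.\<close>

definition ip_vec :: "(real ^ 'n) set \<Rightarrow> (real ^ 'n \<Rightarrow> complex ^ 'n) \<Rightarrow> (real ^ 'n \<Rightarrow> complex ^ 'n) \<Rightarrow> complex"
  where "ip_vec U G H = (\<Sum>i\<in>UNIV. ip U (\<lambda>x. G x $ i) (\<lambda>x. H x $ i))"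

lemma ip_vec_eq:
  assumes "G \<in> L2 U" "H \<in> L2 U"
  shows "ip_vec U G H = (LINT x|lebesgue_on U. (\<Sum>i\<in>UNIV. G x $ i * cnj (H x $ i)))"
  unfolding ip_vec_def ip_def
  by (rule Bochner_Integration.integral_sum[symmetric]) (intro ip_integrable L2_vec_nth assms)

lemma norm_vec_square: "of_real ((norm z)\<^sup>2) = (\<Sum>i\<in>UNIV. z $ i * cnj (z $ i))" for z :: "complex ^ 'n"
  by (simp add: norm_vec_def L2_set_def sum_nonneg complex_norm_square del: of_real_power)

lemma ip_vec_commute: "ip_vec U H G = cnj (ip_vec U G H)"
  unfolding ip_vec_def cnj_sum by (rule sum.cong[OF refl ip_commute])

lemma ip_vec_add_left:
  assumes "F \<in> L2 U" "G \<in> L2 U" "H \<in> L2 U"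
  shows "ip_vec U (\<lambda>x. F x + G x) H = ip_vec U F H + ip_vec U G H"
  unfolding ip_vec_def sum.distrib[symmetric] vector_add_component
  by (intro sum.cong refl ip_add_left L2_vec_nth assms)

lemma ip_vec_add_right:
  assumes "F \<in> L2 U" "G \<in> L2 U" "H \<in> L2 U"
  shows "ip_vec U H (\<lambda>x. F x + G x) = ip_vec U H F + ip_vec U H G"
  using ip_vec_add_left[OF assms] by (metis complex_cnj_add ip_vec_commute)

lemma ip_vec_cong_AE:
  assumes "AE x in lebesgue_on U. G x = G' x" "AE x in lebesgue_on U. H x = H' x"
    and "G \<in> L2 U" "G' \<in> L2 U" "H \<in> L2 U" "H' \<in> L2 U"
  shows "ip_vec U G H = ip_vec U G' H'"
  unfolding ip_vec_def
  by (intro sum.cong refl ip_cong_AE L2_vec_nth assms; use assms(1,2) in \<open>auto elim: eventually_mono\<close>)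

subsection \<open>Energy decay\<close>

text \<open>Young's inequality is applied separately to the two gradient components, with weights
  that use up exactly half of the squared gradient, the amount left over by the implicit Laplacian.
  The price is the centrifugal potential in the second case of the condition on \<alpha>.\<close>

lemma rotation_term_le:
  fixes d :: "complex ^ 'n" and e :: complex
  assumes "k \<noteq> l"
  shows "- \<Omega> * Re (\<i> * (of_real y * d $ k - of_real x * d $ l) * cnj e)
    \<le> (norm d)\<^sup>2 / 2 + \<bar>\<Omega>\<bar>\<^sup>2 / 2 * (x\<^sup>2 + y\<^sup>2) * (cmod e)\<^sup>2"
proof -
  let ?E = "cmod e" and ?dk = "cmod (d $ k)" and ?dl = "cmod (d $ l)"
  have amgm: "s * (\<bar>\<Omega>\<bar> * (\<bar>z\<bar> * ?E)) \<le> s\<^sup>2 / 2 + \<bar>\<Omega>\<bar>\<^sup>2 / 2 * z\<^sup>2 * ?E\<^sup>2" for s z :: real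
    using two_mult_le_weighted[of 1 s "\<bar>\<Omega>\<bar> * (\<bar>z\<bar> * ?E)"] by (simp add: power_mult_distrib)
  \<comment> \<open>Distinctness of \<open>k\<close> and \<open>l\<close> is essential, as otherwise
    one component would be counted twice.\<close>
  have le: "?dk\<^sup>2 + ?dl\<^sup>2 \<le> (norm d)\<^sup>2"
  proof -
    have "?dk\<^sup>2 + ?dl\<^sup>2 = (\<Sum>i\<in>{k, l}. (cmod (d $ i))\<^sup>2)"
      using assms by simp
    also have "\<dots> \<le> (\<Sum>i\<in>UNIV. (cmod (d $ i))\<^sup>2)"
      by (rule sum_mono2) auto
    also have "\<dots> = (norm d)\<^sup>2"
      by (simp add: norm_vec_def L2_set_def sum_nonneg)
    finally show ?thesis .
  qed
  have "- \<Omega> * Re (\<i> * (of_real y * d $ k - of_real x * d $ l) * cnj e)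
      \<le> \<bar>\<Omega>\<bar> * cmod (\<i> * (of_real y * d $ k - of_real x * d $ l) * cnj e)"
    (is "- \<Omega> * Re ?z \<le> _")
  proof -
    have "- \<Omega> * Re ?z \<le> \<bar>\<Omega>\<bar> * \<bar>Re ?z\<bar>"
      using abs_ge_minus_self[of "\<Omega> * Re ?z"] by (simp only: abs_mult mult_minus_left)
    also have "\<dots> \<le> \<bar>\<Omega>\<bar> * cmod ?z"
      by (intro mult_left_mono abs_Re_le_cmod abs_ge_zero)
    finally show ?thesis .
  qed
  also have "\<dots> = \<bar>\<Omega>\<bar> * (cmod (of_real y * d $ k - of_real x * d $ l) * ?E)"
    by (simp add: norm_mult)
  also have "\<dots> \<le> \<bar>\<Omega>\<bar> * ((\<bar>y\<bar> * ?dk + \<bar>x\<bar> * ?dl) * ?E)"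
    by (intro mult_left_mono mult_right_mono order_trans[OF norm_triangle_ineq4])
      (simp_all add: norm_mult)
  also have "\<dots> = ?dk * (\<bar>\<Omega>\<bar> * (\<bar>y\<bar> * ?E)) + ?dl * (\<bar>\<Omega>\<bar> * (\<bar>x\<bar> * ?E))"
    by (simp add: algebra_simps)
  also have "\<dots> \<le> (?dk\<^sup>2 / 2 + \<bar>\<Omega>\<bar>\<^sup>2 / 2 * y\<^sup>2 * ?E\<^sup>2) + (?dl\<^sup>2 / 2 + \<bar>\<Omega>\<bar>\<^sup>2 / 2 * x\<^sup>2 * ?E\<^sup>2)"
    by (intro add_mono amgm)
  also have "\<dots> = (?dk\<^sup>2 + ?dl\<^sup>2) / 2 + \<bar>\<Omega>\<bar>\<^sup>2 / 2 * (x\<^sup>2 + y\<^sup>2) * ?E\<^sup>2"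
    by (simp add: algebra_simps add_divide_distrib)
  also have "\<dots> \<le> (norm d)\<^sup>2 / 2 + \<bar>\<Omega>\<bar>\<^sup>2 / 2 * (x\<^sup>2 + y\<^sup>2) * ?E\<^sup>2"
    using le by simp
  finally show ?thesis .
qed

text \<open>Brings the hypothesis on \<alpha>, stated with an extended real essential supremum, down
  to a real inequality usable under the integral.\<close>

lemma le_of_half_max_esssup:
  fixes f :: "'a \<Rightarrow> real"
  assumes "ereal (1/2) * max 0 (esssup M (\<lambda>x. ereal (f x))) \<le> ereal \<alpha>"
  shows "AE x in M. f x \<le> 2 * \<alpha>"
  using esssup_AE[of "\<lambda>x. ereal (f x)" M]
proof eventually_elim
  case (elim x)
  then have "ereal (f x) \<le> max 0 (esssup M (\<lambda>x. ereal (f x)))"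
    by (simp add: le_max_iff_disj)
  then have "ereal (1/2) * ereal (f x) \<le> ereal (1/2) * max 0 (esssup M (\<lambda>x. ereal (f x)))"
    by (rule ereal_mult_left_mono) simp
  from order_trans[OF this assms] show ?case by simp
qed

text \<open>Rewritten with pairings, the action can be expanded by sesquilinearity alone. Splitting
  the integral requires each summand to be integrable; for the potential term this comes from the
  L^2 hypothesis on the product.\<close>

lemma modified_action_eq:
  fixes U :: "(real ^ 'n) set"
  defines "W \<equiv> \<lambda>V \<omega> \<beta> p \<phi>n x. complex_of_real (V x + \<omega> + \<beta> * cmod (\<phi>n x) powr (p - 1))"
  assumes U: "bounded U" "U \<in> sets lebesgue" and \<phi>: "\<phi> \<in> H1 U"
    and W: "(\<lambda>x. W V \<omega> \<beta> p \<phi>n x * \<phi> x) \<in> L2 U"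
  shows "modified_action \<iota> U p V \<Omega> \<omega> \<beta> \<phi>n \<phi> = 1/2 * ip_vec U (weak_grad U \<phi>) (weak_grad U \<phi>)
    + ip U (\<lambda>x. W V \<omega> \<beta> p \<phi>n x * \<phi> x) \<phi> - of_real \<Omega> * ip U (Lz \<iota> U \<phi>) \<phi>"
proof -
  let ?G = "weak_grad U \<phi>" and ?W = "W V \<omega> \<beta> p \<phi>n"
  note I = ip_integrable[OF L2_vec_nth[OF weak_grad_L2[OF \<phi>]] L2_vec_nth[OF weak_grad_L2[OF \<phi>]]]
    ip_integrable[OF W H1_L2[OF \<phi>]] ip_integrable[OF Lz_L2[OF U \<phi>, of \<iota>] H1_L2[OF \<phi>]]
  have "modified_action \<iota> U p V \<Omega> \<omega> \<beta> \<phi>n \<phi> = (LINT x|lebesgue_on U.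
      1/2 * (\<Sum>i\<in>UNIV. ?G x $ i * cnj (?G x $ i)) + ?W x * \<phi> x * cnj (\<phi> x)
        - of_real \<Omega> * (Lz \<iota> U \<phi> x * cnj (\<phi> x)))"
    unfolding modified_action_def
  proof (rule Bochner_Integration.integral_cong[OF refl])
    fix x
    have "of_real (1/2 * (norm (?G x))\<^sup>2 + (V x + \<omega> + \<beta> * cmod (\<phi>n x) powr (p - 1)) * (cmod (\<phi> x))\<^sup>2)
        = 1/2 * of_real ((norm (?G x))\<^sup>2) + ?W x * of_real ((cmod (\<phi> x))\<^sup>2)"
      unfolding W_def of_real_add of_real_mult by simp
    also have "\<dots> = 1/2 * (\<Sum>i\<in>UNIV. ?G x $ i * cnj (?G x $ i)) + ?W x * \<phi> x * cnj (\<phi> x)"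
      unfolding norm_vec_square complex_norm_square mult.assoc ..
    finally show "of_real (1/2 * (norm (?G x))\<^sup>2 + (V x + \<omega> + \<beta> * cmod (\<phi>n x) powr (p - 1)) * (cmod (\<phi> x))\<^sup>2)
        - of_real \<Omega> * cnj (\<phi> x) * Lz \<iota> U \<phi> x
      = 1/2 * (\<Sum>i\<in>UNIV. ?G x $ i * cnj (?G x $ i)) + ?W x * \<phi> x * cnj (\<phi> x)
        - of_real \<Omega> * (Lz \<iota> U \<phi> x * cnj (\<phi> x))"
      by (simp only: mult.assoc mult.commute[of "cnj (\<phi> x)"])
  qed
  also have "\<dots> = 1/2 * (LINT x|lebesgue_on U. (\<Sum>i\<in>UNIV. ?G x $ i * cnj (?G x $ i)))
      + ip U (\<lambda>x. ?W x * \<phi> x) \<phi> - of_real \<Omega> * ip U (Lz \<iota> U \<phi>) \<phi>"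
    unfolding ip_def integral_mult_right_zero[symmetric]
    by (subst Bochner_Integration.integral_diff Bochner_Integration.integral_add;
        (intro Bochner_Integration.integrable_add integrable_mult_right Bochner_Integration.integrable_sum I)?)+
      (rule refl)
  finally show ?thesis
    by (simp only: ip_vec_eq[OF weak_grad_L2[OF \<phi>] weak_grad_L2[OF \<phi>]])
qed

lemma L2_mult_powr_potential:
  fixes U :: "(real ^ 'n) set" and V :: "real ^ 'n \<Rightarrow> real"
  assumes V: "V \<in> Linf U" and \<phi>: "\<phi> \<in> Linf U" and "p > 1" and f: "f \<in> L2 U"
  shows "(\<lambda>x. complex_of_real (V x + \<omega> + \<beta> * cmod (\<phi> x) powr (p - 1)) * f x) \<in> L2 U"
proof -
  obtain C1 where C1: "AE x in lebesgue_on U. norm (V x) \<le> C1"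
    using V by (auto simp: Linf_def)
  obtain C2 where C2: "AE x in lebesgue_on U. norm (\<phi> x) \<le> C2"
    using \<phi> by (auto simp: Linf_def)
  have [measurable]: "V \<in> borel_measurable (lebesgue_on U)" "\<phi> \<in> borel_measurable (lebesgue_on U)"
    using V \<phi> by (simp_all add: Linf_def)
  show ?thesis
  proof (rule L2_mult_bounded[OF f])
    show "AE x in lebesgue_on U. norm (complex_of_real (V x + \<omega> + \<beta> * cmod (\<phi> x) powr (p - 1)))
        \<le> C1 + \<bar>\<omega>\<bar> + \<bar>\<beta>\<bar> * C2 powr (p - 1)"
      using C1 C2
    proof eventually_elim
      case (elim x)
      have "cmod (\<phi> x) powr (p - 1) \<le> C2 powr (p - 1)"
        using elim(2) \<open>p > 1\<close> by (intro powr_mono2) auto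
      then have "\<bar>\<beta> * cmod (\<phi> x) powr (p - 1)\<bar> \<le> \<bar>\<beta>\<bar> * C2 powr (p - 1)"
        unfolding abs_mult by (intro mult_left_mono) simp_all
      then show ?case
        using elim(1) unfolding norm_of_real real_norm_def by linarith
    qed
  qed measurable
qed

theorem theorem3p4:
  fixes \<iota> :: "nat \<Rightarrow> 'n::finite"
    and a b :: "real ^ 'n"
    and V :: "real ^ 'n \<Rightarrow> real"
    and p \<Omega> \<omega> \<beta> \<alpha> \<tau> :: real
    and \<phi>n \<phi>' :: "real ^ 'n \<Rightarrow> complex"
    and bc :: boundary_condition
  assumes coords: "bij_betw \<iota> {1..CARD('n)} UNIV"
    and p_gt: "1 < p"
    and p_lt: "CARD('n) \<ge> 3 \<Longrightarrow> p < (real CARD('n) + 2) / (real CARD('n) - 2)"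
    and beta: "\<beta> > 0"
    and box: "\<And>i. a $ i < b $ i"
    and V: "V \<in> Linf (box a b)"
    and V_nonneg: "AE x in lebesgue_on (box a b). 0 \<le> V x"
    and phin: "\<phi>n \<in> H1_bc bc a b" "\<phi>n \<in> Linf (box a b)"
    and alpha:
      "CARD('n) = 1 \<and>
       ereal \<alpha> \<ge> ereal (1/2) * max 0 (esssup (lebesgue_on (box a b))
          (\<lambda>x. ereal (V x + \<omega> + \<beta> * cmod (\<phi>n x) powr (p - 1))))
       \<or>
       CARD('n) \<ge> 2 \<and>
       ereal \<alpha> \<ge> ereal (1/2) * max 0 (esssup (lebesgue_on (box a b))
          (\<lambda>x. ereal (V x + \<bar>\<Omega>\<bar>\<^sup>2 / 2 * ((x $ \<iota> 1)\<^sup>2 + (x $ \<iota> 2)\<^sup>2)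
                      + \<omega> + \<beta> * cmod (\<phi>n x) powr (p - 1))))"
    and tau: "\<tau> > 0"
    and sol: "weak_solution bc \<iota> a b p V \<Omega> \<omega> \<beta> \<alpha> \<tau> \<phi>n \<phi>'"
  shows "modified_action \<iota> (box a b) p V \<Omega> \<omega> \<beta> \<phi>n \<phi>' \<le> modified_action \<iota> (box a b) p V \<Omega> \<omega> \<beta> \<phi>n \<phi>n"
proof -
  define U where "U = box a b"
  define W where "W x = complex_of_real (V x + \<omega> + \<beta> * cmod (\<phi>n x) powr (p - 1))" for x
  define L where "L = Lz \<iota> U"
  define e where "e x = \<phi>' x - \<phi>n x" for x
  define g where "g = weak_grad U \<phi>n"
  define g' where "g' = weak_grad U \<phi>'"
  define d where "d = weak_grad U e"
  have U: "open U" "bounded U" "U \<in> sets lebesgue" "U \<in> lmeasurable"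
    by (simp_all add: U_def open_box)
  have bc': "\<phi>' \<in> H1_bc bc a b"
    using sol by (simp add: weak_solution_def)
  have bce: "e \<in> H1_bc bc a b"
    unfolding e_def by (rule H1_bc_diff[OF bc' phin(1)])
  note H = H1_bc_H1[OF phin(1), folded U_def] H1_bc_H1[OF bc', folded U_def] H1_bc_H1[OF bce, folded U_def]
  note L2 = H[THEN H1_L2]
  have L2g: "g \<in> L2 U" "g' \<in> L2 U" "d \<in> L2 U"
    unfolding g_def g'_def d_def by (intro weak_grad_L2 H)+
  have L2W: "(\<lambda>x. W x * f x) \<in> L2 U" if "f \<in> L2 U" for f
    unfolding W_def using L2_mult_powr_potential[OF V phin(2) p_gt that[unfolded U_def]] by (simp only: U_def)
  have L2L: "L \<phi>n \<in> L2 U" "L \<phi>' \<in> L2 U" "L e \<in> L2 U"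
    unfolding L_def by (intro Lz_L2 U H)+
  have \<phi>'_eq: "\<phi>' = (\<lambda>x. \<phi>n x + e x)"
    by (simp add: e_def)
  have g'_eq: "AE x in lebesgue_on U. g' x = g x + d x"
    using weak_grad_diff[OF U(1,4) H(2,1)] unfolding g'_def g_def d_def e_def by eventually_elim simp
  have L'_eq: "AE x in lebesgue_on U. L \<phi>' x = L \<phi>n x + L e x"
    using Lz_diff[OF U(1,4) H(2,1), of \<iota>] unfolding L_def e_def by eventually_elim simp
  have sym: "ip U (L u) v = cnj (ip U (L v) u)" if "u \<in> H1_bc bc a b" "v \<in> H1_bc bc a b" for u v
    unfolding L_def U_def by (rule Lz_symmetric[OF bij_betw_imp_inj_on[OF coords] box that])

  \<comment> \<open>\<open>A\<close>, \<open>D\<close>, \<open>K\<close>, \<open>Z\<close> are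
    quadratic in the increment. \<open>P\<close>, \<open>Q\<close>, \<open>R\<close> are the cross
    terms with \<open>\<phi>n\<close>, which the tested equation eliminates.\<close>
  define A where "A = ip U e e"
  define D where "D = ip_vec U d d"
  define P where "P = ip_vec U g d"
  define Q where "Q = ip U (\<lambda>x. W x * \<phi>n x) e"
  define R where "R = ip U (L \<phi>n) e"
  define K where "K = ip U (\<lambda>x. W x * e x) e"
  define Z where "Z = ip U (L e) e"

  \<comment> \<open>The weak equation with test function \<open>e\<close>, admissible because
    \<open>e\<close> satisfies the boundary condition.\<close>
  have weak0: "ip U (\<lambda>x. (\<phi>' x - \<phi>n x) / of_real \<tau>) e =
      - 1/2 * ip_vec U g' d - of_real \<alpha> * ip U \<phi>' e
      + ip U (\<lambda>x. of_real (\<alpha> - V x - \<omega> - \<beta> * cmod (\<phi>n x) powr (p - 1)) * \<phi>n x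
          + of_real \<Omega> * L \<phi>n x) e"
    using sol bce unfolding weak_solution_def ip_vec_eq[OF L2g(2,3)]
    unfolding ip_def U_def L_def g'_def d_def by blast
  have weak1: "ip U (\<lambda>x. (\<phi>' x - \<phi>n x) / of_real \<tau>) e = A / of_real \<tau>"
    unfolding A_def ip_def e_def by simp
  have weak2: "ip_vec U g' d = P + D"
    unfolding P_def D_def ip_vec_add_left[OF L2g(1,3,3), symmetric]
    by (intro ip_vec_cong_AE g'_eq AE_I2 refl L2_add L2g)
  have weak3: "ip U \<phi>' e = ip U \<phi>n e + A"
    unfolding A_def \<phi>'_eq by (rule ip_add_left[OF L2(1,3,3)])
  have weak4: "ip U (\<lambda>x. of_real (\<alpha> - V x - \<omega> - \<beta> * cmod (\<phi>n x) powr (p - 1)) * \<phi>n x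
      + of_real \<Omega> * L \<phi>n x) e = of_real \<alpha> * ip U \<phi>n e - Q + of_real \<Omega> * R"
  proof -
    have "ip U (\<lambda>x. of_real (\<alpha> - V x - \<omega> - \<beta> * cmod (\<phi>n x) powr (p - 1)) * \<phi>n x
        + of_real \<Omega> * L \<phi>n x) e
      = ip U (\<lambda>x. of_real \<alpha> * \<phi>n x + ((-1) * (W x * \<phi>n x) + of_real \<Omega> * L \<phi>n x)) e"
      by (rule arg_cong[of _ _ "\<lambda>f. ip U f e"]) (simp add: fun_eq_iff W_def algebra_simps)
    also have "\<dots> = ip U (\<lambda>x. of_real \<alpha> * \<phi>n x) e
        + (ip U (\<lambda>x. (-1) * (W x * \<phi>n x)) e + ip U (\<lambda>x. of_real \<Omega> * L \<phi>n x) e)"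
      by (subst ip_add_left ip_add_left; (intro L2_add L2_cmult L2W L2 L2L)?)+ (rule refl)
    also have "\<dots> = of_real \<alpha> * ip U \<phi>n e + ((-1) * Q + of_real \<Omega> * R)"
      unfolding Q_def R_def ip_def mult.assoc integral_mult_right_zero ..
    finally show ?thesis by simp
  qed
  have weak: "A / of_real \<tau> = - 1/2 * (P + D) - of_real \<alpha> * A - Q + of_real \<Omega> * R"
    using weak0 unfolding weak1 weak2 weak3 weak4 by (simp add: algebra_simps)

  have action: "modified_action \<iota> U p V \<Omega> \<omega> \<beta> \<phi>n \<phi> =
      1/2 * ip_vec U (weak_grad U \<phi>) (weak_grad U \<phi>) + ip U (\<lambda>x. W x * \<phi> x) \<phi>
      - of_real \<Omega> * ip U (L \<phi>) \<phi>" if "\<phi> \<in> H1 U" for \<phi>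
    unfolding L_def W_def
    by (rule modified_action_eq[OF U(2,3) that L2W[OF H1_L2[OF that], unfolded W_def]])
  have "ip_vec U g' g' = ip_vec U g g + P + cnj P + D"
  proof -
    have "ip_vec U g' g' = ip_vec U (\<lambda>x. g x + d x) (\<lambda>x. g x + d x)"
      by (intro ip_vec_cong_AE g'_eq L2_add L2g)
    also have "\<dots> = (ip_vec U g g + P) + (ip_vec U d g + D)"
      unfolding P_def D_def
      by (subst ip_vec_add_left ip_vec_add_right; (intro L2_add L2g)?)+ (rule refl)
    finally show ?thesis
      by (simp add: P_def ip_vec_commute[of U d g])
  qed
  moreover have "ip U (\<lambda>x. W x * \<phi>' x) \<phi>' = ip U (\<lambda>x. W x * \<phi>n x) \<phi>n + Q + cnj Q + K"
  proof -
    have "ip U (\<lambda>x. W x * \<phi>' x) \<phi>' = ip U (\<lambda>x. W x * \<phi>n x + W x * e x) (\<lambda>x. \<phi>n x + e x)"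
      by (simp add: \<phi>'_eq distrib_left)
    also have "\<dots> = (ip U (\<lambda>x. W x * \<phi>n x) \<phi>n + Q) + (ip U (\<lambda>x. W x * e x) \<phi>n + K)"
      unfolding Q_def K_def
      by (subst ip_add_left ip_add_right; (intro L2_add L2W L2)?)+ (rule refl)
    \<comment> \<open>Multiplication by a real potential is symmetric, so the second cross term is
      the conjugate of the first.\<close>
    also have "ip U (\<lambda>x. W x * e x) \<phi>n = cnj Q"
      unfolding Q_def ip_commute[symmetric] unfolding ip_def
      by (rule Bochner_Integration.integral_cong) (simp_all add: W_def)
    finally show ?thesis by simp
  qed
  \<comment> \<open>Symmetry of \<open>Lz\<close> turns the second cross term into
    \<open>cnj R\<close>; only \<open>Re R\<close> survives, and the real part of the tested
    equation controls it.\<close>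
  moreover have "ip U (L \<phi>') \<phi>' = ip U (L \<phi>n) \<phi>n + R + cnj R + Z"
  proof -
    have "ip U (L \<phi>') \<phi>' = ip U (\<lambda>x. L \<phi>n x + L e x) (\<lambda>x. \<phi>n x + e x)"
      by (intro ip_cong_AE L'_eq L2_add L2 L2L) (simp add: \<phi>'_eq)
    also have "\<dots> = (ip U (L \<phi>n) \<phi>n + R) + (ip U (L e) \<phi>n + Z)"
      unfolding R_def Z_def
      by (subst ip_add_left ip_add_right; (intro L2_add L2 L2L)?)+ (rule refl)
    finally show ?thesis
      by (simp add: R_def sym[OF bce phin(1)])
  qed
  ultimately have diff: "modified_action \<iota> U p V \<Omega> \<omega> \<beta> \<phi>n \<phi>' - modified_action \<iota> U p V \<Omega> \<omega> \<beta> \<phi>n \<phi>n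
      = 1/2 * (P + cnj P + D) + (Q + cnj Q + K) - of_real \<Omega> * (R + cnj R + Z)"
    unfolding action[OF H(1)] action[OF H(2)] g_def[symmetric] g'_def[symmetric] by (simp add: algebra_simps)

  \<comment> \<open>Needed for equality of the imaginary parts. The cross terms occur together with
    their conjugates, so only the purely quadratic terms and \<Omega> times such a term remain to be
    checked.\<close>
  have real: "Im A = 0" "Im D = 0" "Im K = 0" "Im Z = 0"
  proof -
    have "K = cnj K"
      unfolding K_def ip_commute[symmetric] unfolding ip_def
      by (rule Bochner_Integration.integral_cong) (simp_all add: W_def)
    then show "Im K = 0" by (simp add: complex_eq_iff)
    show "Im A = 0" "Im D = 0" "Im Z = 0"
      using ip_commute[of U e e] ip_vec_commute[of U d d] sym[OF bce bce]
      unfolding A_def D_def Z_def by (simp_all add: complex_eq_iff)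
  qed
  have "Re A \<ge> 0"
    unfolding A_def ip_self_eq by (simp add: Bochner_Integration.integral_nonneg)

  \<comment> \<open>Nonnegativity of the form that remains after elimination: its negative, together
    with \<open>-2 Re A / \<tau>\<close>, will be the change of the action. It is proved pointwise
    under one integral.\<close>
  have "0 \<le> Re (of_real (2 * \<alpha>) * A + 1/2 * D - K + of_real \<Omega> * Z)"
  proof -
    define F where "F x = of_real (2 * \<alpha>) * (e x * cnj (e x)) + 1/2 * (\<Sum>i\<in>UNIV. d x $ i * cnj (d x $ i))
      - W x * e x * cnj (e x) + of_real \<Omega> * (L e x * cnj (e x))" for x
    note I = ip_integrable[OF L2(3) L2(3)] ip_integrable[OF L2W[OF L2(3)] L2(3)] ip_integrable[OF L2L(3) L2(3)]
      ip_integrable[OF L2_vec_nth[OF L2g(3)] L2_vec_nth[OF L2g(3)]]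
    have "integrable (lebesgue_on U) F"
      unfolding F_def
      by (intro Bochner_Integration.integrable_add Bochner_Integration.integrable_diff
          Bochner_Integration.integrable_sum integrable_mult_right I)
    have "of_real (2 * \<alpha>) * A + 1/2 * D - K + of_real \<Omega> * Z = (LINT x|lebesgue_on U. F x)"
      unfolding A_def D_def K_def Z_def ip_vec_eq[OF L2g(3,3)] ip_def F_def integral_mult_right_zero[symmetric]
      by (subst Bochner_Integration.integral_diff Bochner_Integration.integral_add;
          (intro Bochner_Integration.integrable_add Bochner_Integration.integrable_diff
            Bochner_Integration.integrable_sum integrable_mult_right I)?)+ (rule refl)
    also have "Re \<dots> = (LINT x|lebesgue_on U. Re (F x))"
      by (rule integral_Re[symmetric]) fact
    also have "\<dots> \<ge> 0"
    proof (rule integral_nonneg_AE)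
      have ReF: "Re (F x) = (2 * \<alpha> - (V x + \<omega> + \<beta> * cmod (\<phi>n x) powr (p - 1))) * (cmod (e x))\<^sup>2
          + (norm (d x))\<^sup>2 / 2 + \<Omega> * Re (L e x * cnj (e x))" for x
        unfolding F_def norm_vec_square[symmetric]
        unfolding mult.assoc complex_norm_square[symmetric] W_def
        unfolding of_real_mult[symmetric] by (simp add: algebra_simps del: of_real_power)
      show "AE x in lebesgue_on U. 0 \<le> Re (F x)"
        using alpha
      proof (elim disjE conjE)
        assume c: "CARD('n) = 1" and "ereal \<alpha> \<ge> ereal (1/2) * max 0 (esssup (lebesgue_on (box a b))
          (\<lambda>x. ereal (V x + \<omega> + \<beta> * cmod (\<phi>n x) powr (p - 1))))"
        from le_of_half_max_esssup[OF this(2)] show ?thesis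
          unfolding U_def[symmetric]
        proof eventually_elim
          case (elim x)
          then show ?case
            \<comment> \<open>In one dimension the rotation term is 0 and the gradient term is
              simply dropped as nonnegative.\<close>
            unfolding ReF using c by (simp add: L_def Lz_def)
        qed
      next
        assume c: "CARD('n) \<ge> 2" and "ereal \<alpha> \<ge> ereal (1/2) * max 0 (esssup (lebesgue_on (box a b))
          (\<lambda>x. ereal (V x + \<bar>\<Omega>\<bar>\<^sup>2 / 2 * ((x $ \<iota> 1)\<^sup>2 + (x $ \<iota> 2)\<^sup>2)
                      + \<omega> + \<beta> * cmod (\<phi>n x) powr (p - 1))))"
        have kl: "\<iota> 1 \<noteq> \<iota> 2"
          using inj_onD[OF bij_betw_imp_inj_on[OF coords], of 1 2] c by auto
        from le_of_half_max_esssup[OF \<open>ereal \<alpha> \<ge> _\<close>] show ?thesis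
          unfolding U_def[symmetric]
        proof eventually_elim
          case (elim x)
          have Le: "L e x = \<i> * (of_real (x $ \<iota> 2) * d x $ \<iota> 1 - of_real (x $ \<iota> 1) * d x $ \<iota> 2)"
            using c by (simp add: L_def Lz_def d_def)
          \<comment> \<open>The centrifugal part of the bound on \<alpha> is what the rotation
            estimate costs; adding the two inequalities leaves \<open>Re (F x)\<close>.\<close>
          have "0 \<le> (2 * \<alpha> - (V x + \<bar>\<Omega>\<bar>\<^sup>2 / 2 * ((x $ \<iota> 1)\<^sup>2 + (x $ \<iota> 2)\<^sup>2)
              + \<omega> + \<beta> * cmod (\<phi>n x) powr (p - 1))) * (cmod (e x))\<^sup>2"
            using elim by simp
          then show ?case
            using rotation_term_le[OF kl, of \<Omega> "x $ \<iota> 2" "d x" "x $ \<iota> 1" "e x"]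
            unfolding ReF Le[symmetric] by (simp add: algebra_simps)
        qed
      qed
    qed
    finally show ?thesis .
  qed
  then have main: "0 \<le> 2 * (\<alpha> * Re A) + Re D / 2 - Re K + \<Omega> * Re Z"
    by simp

  have "Re (modified_action \<iota> U p V \<Omega> \<omega> \<beta> \<phi>n \<phi>' - modified_action \<iota> U p V \<Omega> \<omega> \<beta> \<phi>n \<phi>n)
      = Re P + Re D / 2 + 2 * Re Q + Re K - 2 * (\<Omega> * Re R) - \<Omega> * Re Z"
    unfolding diff by (simp add: algebra_simps)
  moreover have "Re A / \<tau> = - (Re P / 2) - Re D / 2 - \<alpha> * Re A - Re Q + \<Omega> * Re R"
    using arg_cong[OF weak, of Re] by (simp add: field_simps)
  \<comment> \<open>Twice the tested equation replaces
    \<open>Re P + 2 Re Q - 2 \<Omega> Re R\<close> by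
    \<open>-2 Re A / \<tau> - Re D - 2 \<alpha> Re A\<close>; thereby \<open>+1/2 Re D\<close>
    becomes \<open>-1/2 Re D\<close>.\<close>
  ultimately have "Re (modified_action \<iota> U p V \<Omega> \<omega> \<beta> \<phi>n \<phi>' - modified_action \<iota> U p V \<Omega> \<omega> \<beta> \<phi>n \<phi>n)
      = - 2 * (Re A / \<tau>) - (2 * (\<alpha> * Re A) + Re D / 2 - Re K + \<Omega> * Re Z)"
    by linarith
  also have "\<dots> \<le> 0"
    using main divide_nonneg_pos[OF \<open>Re A \<ge> 0\<close> tau] by linarith
  finally have "Re (modified_action \<iota> U p V \<Omega> \<omega> \<beta> \<phi>n \<phi>') \<le> Re (modified_action \<iota> U p V \<Omega> \<omega> \<beta> \<phi>n \<phi>n)"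
    by simp
  moreover have "Im (modified_action \<iota> U p V \<Omega> \<omega> \<beta> \<phi>n \<phi>' - modified_action \<iota> U p V \<Omega> \<omega> \<beta> \<phi>n \<phi>n) = 0"
    unfolding diff using real by simp
  ultimately show ?thesis
    unfolding U_def by (simp add: less_eq_complex_def)
qed

end
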